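(* Let $E$ be an arbitrary directed graph and $K$ any field. Suppose $I$ is a simple (i.e. minimal) left ideal of the Leavitt path algebra $L_K(E)$. Then $I\cong L_K(E)v$ as left $L_K(E)$-modules for some line point $v\in E^0$.
   Context: Leavitt path algebra: for a directed graph $E=(E^0,E^1,s,r)$ and a field $K$, $L_K(E)$ is the associative $K$-algebra (not necessarily unital) generated by $\{u: u\in E^0\}\cup\{e,e^*: e\in E^1\}$ subject to: $uw=\delta_{u,w}u$ for $u,w\in E^0$; $s(e)e=e=e\,r(e)$ and $r(e)e^*=e^*=e^*s(e)$ for $e\in E^1$; (CK1) $e^*f=\delta_{e,f}r(e)$ for $e,f\in E^1$; (CK2) $u=\sum_{e\in s^{-1}(u)}ee^*$ for every regular vertex $u$ (i.e. $0<|s^{-1}(u)|<\infty$). Paths are vertices, or finite sequences $e_1\cdots e_m$ of edges with $r(e_i)=s(e_{i+1})$. For $v\in E^0$, $T(v)$ is the set of vertices $w$ such that there is a path from $v$ to $w$ (including $v$ itself). A cycle is a closed path $e_1\cdots e_n$ (with $r(e_n)=s(e_1)$) with $s(e_i)\neq s(e_j)$ for $i\ne j$. A vertex $v$ is a line point if no vertex of $T(v)$ is a bifurcation (i.e. emits two or more edges) or is the base of a cycle. *)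

theory Defs
  imports
    "HOL-Algebra.QuotRing"
    "HOL-Library.Poly_Mapping"
    "Graph_Theory.Arc_Walk"
begin

section \<open>Line points\<close>

text \<open>
  Directed graphs are taken from Graph_Theory: a \<^locale>\<open>wf_digraph\<close> may be infinite and may have
  loops and parallel edges. The source of an edge is its \<^const>\<open>tail\<close>, the range its \<^const>\<open>head\<close>.
\<close>

definition descendants :: "('v, 'e) pre_digraph \<Rightarrow> 'v \<Rightarrow> 'v set"
  where "descendants E v = {w. \<exists>p. pre_digraph.awalk E v p w}"

definition bifurcation :: "('v, 'e) pre_digraph \<Rightarrow> 'v \<Rightarrow> bool"
  where "bifurcation E v \<longleftrightarrow> (\<exists>e \<in> out_arcs E v. \<exists>f \<in> out_arcs E v. e \<noteq> f)"

text \<open>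
  The library predicate \<^const>\<open>pre_digraph.cycle\<close> asks for the ranges of the edges of a non-empty
  closed walk to be distinct; on a closed walk the sources are the same vertices, shifted by one.
\<close>

definition cycle_base :: "('v, 'e) pre_digraph \<Rightarrow> 'v \<Rightarrow> bool"
  where "cycle_base E v \<longleftrightarrow> (\<exists>p. pre_digraph.cycle E p \<and> tail E (hd p) = v)"

definition line_point :: "('v, 'e) pre_digraph \<Rightarrow> 'v \<Rightarrow> bool"
  where "line_point E v \<longleftrightarrow>
    v \<in> verts E \<and> (\<forall>w \<in> descendants E v. \<not> bifurcation E w \<and> \<not> cycle_base E w)"

definition regular_vertex :: "('v, 'e) pre_digraph \<Rightarrow> 'v \<Rightarrow> bool"
  where "regular_vertex E v \<longleftrightarrow> v \<in> verts E \<and> out_arcs E v \<noteq> {} \<and> finite (out_arcs E v)"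


section \<open>Free associative algebras\<close>

text \<open>
  With concatenation as addition of exponents, the convolution product on
  \<^typ>\<open>'a list \<Rightarrow>\<^sub>0 'k\<close> is the product of non-commutative polynomials.
\<close>

instantiation list :: (type) monoid_add
begin

definition plus_list :: "'a list \<Rightarrow> 'a list \<Rightarrow> 'a list"
  where "plus_list xs ys = xs @ ys"

definition zero_list :: "'a list"
  where "zero_list = []"

instance
  by standard (simp_all add: plus_list_def zero_list_def)

end

definition free_algebra :: "'a set \<Rightarrow> ('a list \<Rightarrow>\<^sub>0 'k::field) ring"
  where "free_algebra X =
    \<lparr>carrier = {p. Poly_Mapping.keys p \<subseteq> lists X}, mult = (*), one = 1, zero = 0, add = (+)\<rparr>"

text \<open>
  The free algebra without unit consists of the polynomials with constant coefficient 0. Here and in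
  its quotient below, the \<^const>\<open>one\<close> component of the record carries no meaning.
\<close>

definition free_nonunital_algebra :: "'a set \<Rightarrow> ('a list \<Rightarrow>\<^sub>0 'k::field) ring"
  where "free_nonunital_algebra X =
    free_algebra X \<lparr>carrier := {p \<in> carrier (free_algebra X). Poly_Mapping.lookup p [] = 0}\<rparr>"

definition generator :: "'a \<Rightarrow> ('a list \<Rightarrow>\<^sub>0 'k::field)"
  where "generator x = Poly_Mapping.single [x] 1"


section \<open>Leavitt path algebras\<close>

datatype ('v, 'e) lpa_gen = Vertex 'v | Edge 'e | Ghost 'e

type_synonym ('v, 'e, 'k) free_lpa = "('v, 'e) lpa_gen list \<Rightarrow>\<^sub>0 'k"

type_synonym ('v, 'e, 'k) lpa = "('v, 'e, 'k) free_lpa set"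

definition lpa_gens :: "('v, 'e) pre_digraph \<Rightarrow> ('v, 'e) lpa_gen set"
  where "lpa_gens E = Vertex ` verts E \<union> Edge ` arcs E \<union> Ghost ` arcs E"

text \<open>An equation \<open>a = b\<close> between generators is recorded as the element \<open>a - b\<close>.\<close>

definition lpa_relations :: "('v, 'e) pre_digraph \<Rightarrow> ('v, 'e, 'k::field) free_lpa set"
  where "lpa_relations E =
    (let V = (\<lambda>u. generator (Vertex u));
         X = (\<lambda>e. generator (Edge e));
         Y = (\<lambda>e. generator (Ghost e))
     in  {V u * V w - (if u = w then V u else 0) | u w. u \<in> verts E \<and> w \<in> verts E}
       \<union> {V (tail E e) * X e - X e | e. e \<in> arcs E}
       \<union> {X e * V (head E e) - X e | e. e \<in> arcs E}
       \<union> {V (head E e) * Y e - Y e | e. e \<in> arcs E}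
       \<union> {Y e * V (tail E e) - Y e | e. e \<in> arcs E}
       \<union> {Y e * X f - (if e = f then V (head E e) else 0) | e f. e \<in> arcs E \<and> f \<in> arcs E}
       \<union> {V u - (\<Sum>e \<in> out_arcs E u. X e * Y e) | u. regular_vertex E u})"

text \<open>
  \<^const>\<open>genideal\<close> is only meaningful in a ring with unit, so the ideal is generated in the unital free
  algebra \<open>K \<oplus> F\<close>, where \<open>F\<close> is the free algebra without unit. All relations lie in \<open>F\<close>, hence so
  does the ideal, and it coincides with the algebra ideal of \<open>F\<close> generated by the relations.
\<close>

definition lpa_ideal :: "('v, 'e) pre_digraph \<Rightarrow> ('v, 'e, 'k::field) free_lpa set"
  where "lpa_ideal E = Idl\<^bsub>free_algebra (lpa_gens E)\<^esub> (lpa_relations E)"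

definition leavitt_path_algebra :: "('v, 'e) pre_digraph \<Rightarrow> ('v, 'e, 'k::field) lpa ring"
  where "leavitt_path_algebra E = free_nonunital_algebra (lpa_gens E) Quot lpa_ideal E"

definition lpa_vertex :: "('v, 'e) pre_digraph \<Rightarrow> 'v \<Rightarrow> ('v, 'e, 'k::field) lpa"
  where "lpa_vertex E v =
    lpa_ideal E +>\<^bsub>free_nonunital_algebra (lpa_gens E)\<^esub> generator (Vertex v)"


section \<open>Left ideals of rings that need not have a unit\<close>

text \<open>
  Closure under scalars is not required: in a Leavitt path algebra every \<open>x\<close> has an idempotent \<open>u\<close>
  with \<open>u \<cdot> x = x\<close>, whence \<open>c x = (c u) \<cdot> x\<close>, and left ideals are subspaces. In the same way,
  additive maps between left ideals that commute with the left action are linear.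
\<close>

definition left_ideal :: "'a set \<Rightarrow> ('a, 'm) ring_scheme \<Rightarrow> bool"
  where "left_ideal I R \<longleftrightarrow>
    additive_subgroup I R \<and> (\<forall>a \<in> carrier R. \<forall>x \<in> I. a \<otimes>\<^bsub>R\<^esub> x \<in> I)"

definition minimal_left_ideal :: "'a set \<Rightarrow> ('a, 'm) ring_scheme \<Rightarrow> bool"
  where "minimal_left_ideal I R \<longleftrightarrow>
    left_ideal I R \<and> I \<noteq> {\<zero>\<^bsub>R\<^esub>} \<and>
    (\<forall>J. left_ideal J R \<and> J \<subseteq> I \<longrightarrow> J = {\<zero>\<^bsub>R\<^esub>} \<or> J = I)"

definition left_module_isomorphic :: "('a, 'm) ring_scheme \<Rightarrow> 'a set \<Rightarrow> 'a set \<Rightarrow> bool"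
  where "left_module_isomorphic R M N \<longleftrightarrow>
    (\<exists>h. bij_betw h M N \<and>
         (\<forall>x \<in> M. \<forall>y \<in> M. h (x \<oplus>\<^bsub>R\<^esub> y) = h x \<oplus>\<^bsub>R\<^esub> h y) \<and>
         (\<forall>a \<in> carrier R. \<forall>x \<in> M. h (a \<otimes>\<^bsub>R\<^esub> x) = a \<otimes>\<^bsub>R\<^esub> h x))"


section \<open>Well-definedness\<close>

lemma free_algebra_simps [simp]:
  "carrier (free_algebra X) = {p. Poly_Mapping.keys p \<subseteq> lists X}"
  "mult (free_algebra X) = (*)"
  "one (free_algebra X) = 1"
  "zero (free_algebra X) = 0"
  "add (free_algebra X) = (+)"
  by (simp_all add: free_algebra_def)

lemma free_nonunital_algebra_simps [simp]:
  "carrier (free_nonunital_algebra X) =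
    {p. Poly_Mapping.keys p \<subseteq> lists X \<and> Poly_Mapping.lookup p [] = 0}"
  "mult (free_nonunital_algebra X) = (*)"
  "zero (free_nonunital_algebra X) = 0"
  "add (free_nonunital_algebra X) = (+)"
  by (auto simp: free_nonunital_algebra_def)

lemma keys_mult_lists:
  fixes p q :: "'a list \<Rightarrow>\<^sub>0 'k::field"
  assumes "Poly_Mapping.keys p \<subseteq> lists X" "Poly_Mapping.keys q \<subseteq> lists X"
  shows "Poly_Mapping.keys (p * q) \<subseteq> lists X"
proof
  fix w assume "w \<in> Poly_Mapping.keys (p * q)"
  then obtain a b where "a \<in> Poly_Mapping.keys p" "b \<in> Poly_Mapping.keys q" "w = a + b"
    using keys_mult[of p q] by blast
  then show "w \<in> lists X"
    using assms by (auto simp: plus_list_def)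
qed

lemma ring_free_algebra: "ring (free_algebra X :: ('a list \<Rightarrow>\<^sub>0 'k::field) ring)"
proof (rule ringI)
  show "abelian_group (free_algebra X :: ('a list \<Rightarrow>\<^sub>0 'k) ring)"
  proof (rule abelian_groupI; simp?)
    fix p q :: "'a list \<Rightarrow>\<^sub>0 'k"
    assume "Poly_Mapping.keys p \<subseteq> lists X" "Poly_Mapping.keys q \<subseteq> lists X"
    then show "Poly_Mapping.keys (p + q) \<subseteq> lists X"
      using Poly_Mapping.keys_add[of p q] by blast
  next
    fix p :: "'a list \<Rightarrow>\<^sub>0 'k"
    assume "Poly_Mapping.keys p \<subseteq> lists X"
    then show "\<exists>q. Poly_Mapping.keys q \<subseteq> lists X \<and> q + p = 0"
      by (intro exI[of _ "- p"]) simp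
  qed
  show "Group.monoid (free_algebra X :: ('a list \<Rightarrow>\<^sub>0 'k) ring)"
    by (rule monoidI) (auto simp: zero_list_def mult.assoc dest: subsetD[OF keys_mult_lists])
qed (simp_all add: algebra_simps)

lemma keys_generator [simp]: "Poly_Mapping.keys (generator x :: 'a list \<Rightarrow>\<^sub>0 'k::field) = {[x]}"
  by (simp add: generator_def)

lemma lookup_mult_Nil:
  fixes p q :: "'a list \<Rightarrow>\<^sub>0 'k::field"
  assumes "Poly_Mapping.lookup p [] = 0 \<or> Poly_Mapping.lookup q [] = 0"
  shows "Poly_Mapping.lookup (p * q) [] = 0"
proof (rule ccontr)
  assume "\<not> ?thesis"
  then have "[] \<in> Poly_Mapping.keys (p * q)"
    by (simp add: in_keys_iff)
  then obtain a b where "a \<in> Poly_Mapping.keys p" "b \<in> Poly_Mapping.keys q" "[] = a + b"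
    using keys_mult[of p q] by blast
  then show False
    using assms by (auto simp: plus_list_def in_keys_iff)
qed

lemma ideal_free_nonunital_algebra:
  "ideal (carrier (free_nonunital_algebra X)) (free_algebra X :: ('a list \<Rightarrow>\<^sub>0 'k::field) ring)"
proof (rule idealI[OF ring_free_algebra])
  interpret R: ring "free_algebra X :: ('a list \<Rightarrow>\<^sub>0 'k) ring"
    by (rule ring_free_algebra)
  have inv: "inv\<^bsub>add_monoid (free_algebra X)\<^esub> p = - p"
    if "p \<in> carrier (free_algebra X)" for p :: "'a list \<Rightarrow>\<^sub>0 'k"
    using that R.minus_equality[of "- p" p] by (simp add: a_inv_def)
  show "subgroup (carrier (free_nonunital_algebra X))
      (add_monoid (free_algebra X :: ('a list \<Rightarrow>\<^sub>0 'k) ring))"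
  proof
    fix p q :: "'a list \<Rightarrow>\<^sub>0 'k"
    assume "p \<in> carrier (free_nonunital_algebra X)" "q \<in> carrier (free_nonunital_algebra X)"
    then show "p \<otimes>\<^bsub>add_monoid (free_algebra X)\<^esub> q \<in> carrier (free_nonunital_algebra X)"
      using Poly_Mapping.keys_add[of p q] by (auto simp: lookup_add)
  next
    fix p :: "'a list \<Rightarrow>\<^sub>0 'k"
    assume "p \<in> carrier (free_nonunital_algebra X)"
    then show "inv\<^bsub>add_monoid (free_algebra X)\<^esub> p \<in> carrier (free_nonunital_algebra X)"
      by (subst inv) simp_all
  qed auto
qed (auto simp: lookup_mult_Nil dest: subsetD[OF keys_mult_lists])

context wf_digraph
begin

lemma lpa_relations_subset:
  "(lpa_relations G :: ('a, 'b, 'k::field) free_lpa set)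
    \<subseteq> carrier (free_nonunital_algebra (lpa_gens G))"
proof -
  let ?F = "free_algebra (lpa_gens G) :: (('a, 'b) lpa_gen list \<Rightarrow>\<^sub>0 'k) ring"
  let ?N = "carrier (free_nonunital_algebra (lpa_gens G)) :: ('a, 'b, 'k) free_lpa set"
  interpret R: ring ?F
    by (rule ring_free_algebra)
  interpret J: ideal ?N ?F
    by (rule ideal_free_nonunital_algebra)
  have gen: "generator x \<in> ?N" if "x \<in> lpa_gens G" for x
    using that by (simp add: generator_def lookup_single)
  have V: "generator (Vertex u) \<in> ?N" if "u \<in> verts G" for u
    using that by (intro gen) (simp add: lpa_gens_def)
  have XY: "generator (Edge e) \<in> ?N" "generator (Ghost e) \<in> ?N" if "e \<in> arcs G" for e
    using that by (intro gen; simp add: lpa_gens_def)+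
  have add: "p + q \<in> ?N" if "p \<in> ?N" "q \<in> ?N" for p q
    using J.a_closed[of p q] that by simp
  have diff: "p - q \<in> ?N" if "p \<in> ?N" "q \<in> ?N" for p q
    using add[of p "- q"] that by simp
  have mult: "p * q \<in> ?N" if "p \<in> ?N" "q \<in> ?N" for p q
    using J.I_l_closed[of q p] that by simp
  have zero: "0 \<in> ?N"
    by simp
  have sum: "(\<Sum>e\<in>A. f e) \<in> ?N" if "\<And>e. e \<in> A \<Longrightarrow> f e \<in> ?N" for A :: "'b set" and f
    using that
  proof (induction A rule: infinite_finite_induct)
    case (insert e A)
    then have "f e + (\<Sum>e\<in>A. f e) \<in> ?N"
      by (intro add) blast+
    then show ?case
      using insert.hyps by (simp del: free_nonunital_algebra_simps)
  next
    case (infinite A)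
    show ?case
      unfolding sum.infinite[OF infinite.hyps] by (rule zero)
  qed (simp only: sum.empty zero)
  note [simp del] = free_nonunital_algebra_simps
  show ?thesis
    unfolding lpa_relations_def Let_def
    by (auto intro!: diff mult V XY zero sum simp: regular_vertex_def)
qed

lemma ideal_lpa_ideal:
  "ideal (lpa_ideal G :: ('a, 'b, 'k::field) free_lpa set) (free_algebra (lpa_gens G))"
proof -
  interpret R: ring "free_algebra (lpa_gens G) :: (('a, 'b) lpa_gen list \<Rightarrow>\<^sub>0 'k) ring"
    by (rule ring_free_algebra)
  show ?thesis
    unfolding lpa_ideal_def
    using lpa_relations_subset by (intro R.genideal_ideal) auto
qed

lemma lpa_ideal_subset:
  "(lpa_ideal G :: ('a, 'b, 'k::field) free_lpa set)
    \<subseteq> carrier (free_nonunital_algebra (lpa_gens G))"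
  unfolding lpa_ideal_def genideal_def
  using ideal_free_nonunital_algebra lpa_relations_subset by blast

lemma lpa_relations_subset_ideal:
  "(lpa_relations G :: ('a, 'b, 'k::field) free_lpa set) \<subseteq> lpa_ideal G"
  unfolding lpa_ideal_def genideal_def by blast

lemma lpa_mult_cosets:
  fixes p q :: "('a, 'b, 'k::field) free_lpa"
  defines "F \<equiv> free_nonunital_algebra (lpa_gens G)"
  assumes "p \<in> carrier F" "q \<in> carrier F"
  shows "(lpa_ideal G +>\<^bsub>F\<^esub> p) \<otimes>\<^bsub>leavitt_path_algebra G\<^esub> (lpa_ideal G +>\<^bsub>F\<^esub> q)
    = lpa_ideal G +>\<^bsub>F\<^esub> (p * q)"
proof -
  let ?U = "free_algebra (lpa_gens G) :: (('a, 'b) lpa_gen list \<Rightarrow>\<^sub>0 'k) ring"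
  interpret J: ideal "lpa_ideal G" ?U
    by (rule ideal_lpa_ideal)
  have coset: "lpa_ideal G +>\<^bsub>F\<^esub> x = lpa_ideal G +>\<^bsub>?U\<^esub> x" for x
    by (simp add: F_def a_r_coset_def')
  have "rcoset_mult F (lpa_ideal G) A B = rcoset_mult ?U (lpa_ideal G) A B" for A B
    by (simp add: rcoset_mult_def coset) (simp add: F_def)
  then show ?thesis
    using J.rcoset_mult_add[of p q] assms(2,3)
    by (simp add: leavitt_path_algebra_def FactRing_def coset flip: F_def) (simp add: F_def)
qed

end

end

theory Submission
  imports Defs "HOL-Computational_Algebra.Polynomial_FPS"
begin

text \<open>
  Right multiplication by \<open>n\<close> with \<open>I n \<noteq> 0\<close> is an isomorphism from a minimal left ideal \<open>I\<close> onto the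
  minimal left ideal \<open>I n\<close>, so it suffices to move a vertex \<open>v\<close> into \<open>I\<close> by multiplications: then
  \<open>I = L v\<close>. Right multiplication by edges removes ghost edges; left multiplication by ghost paths
  turns a nonzero combination of real paths into \<open>y = k v + \<dots>\<close> with \<open>k \<noteq> 0\<close>, whose other terms are
  paths of positive length. Let \<open>p\<close> be one of them and \<open>q = p p p \<dots>\<close>. If some prefix \<open>\<nu>\<close> of \<open>q\<close> is no
  prefix of \<open>p' \<nu>\<close> for another term \<open>p'\<close>, then passing to \<open>\<nu>\<^sup>* y \<nu>\<close> loses a term. Otherwise \<open>q\<close>
  is an eigenvector of \<open>y\<close> in a representation over \<open>K[[t]]\<close> on functions of infinite paths, and
  \<open>(v - p) y\<close> generates a proper nonzero submodule. The last argument, applied to \<open>y = w\<close>, also shows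
  that no cycle is based at a vertex \<open>w\<close> of \<open>T(v)\<close>, and a bifurcation at \<open>w\<close> splits \<open>L w\<close>.
\<close>

section \<open>Minimal left ideals\<close>

text \<open>With coefficients in \<open>K\<close> and every edge acting as a plain shift,
  \<open>v - p\<close> would kill the indicator of \<open>q\<close>, and the eigenvalue of
  \<open>y\<close>, the sum of its coefficients, could vanish. Weighting each edge by 1 + t turns
  eigenvalues into polynomials in 1 + t. As 1 + t is transcendental over \<open>K\<close>, such a
  value is nonzero once the constant coefficient of the polynomial is nonzero, and for
  \<open>y\<close> this coefficient is the \<open>k\<close> in front of \<open>v\<close>. On the
  other hand 1 - (1 + t)^n has constant term 0 as a power series in t. So it is nonzero and yet no
  unit, which is what a proper nonzero submodule needs. The same action supplies the nonvanishing of
  vertices and of combinations of paths.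

  The argument runs in a subset \<open>R\<close> of a type of class \<open>ring\<close>, where the
  ring laws are available to the simplifier. The algebra itself is a record of cosets; it is
  therefore realised faithfully inside such a type, and left ideals and the isomorphism are carried
  across.\<close>

locale subrng =
  fixes R :: "'r::ring set"
  assumes R_zero: "0 \<in> R"
    and R_add: "\<lbrakk>x \<in> R; y \<in> R\<rbrakk> \<Longrightarrow> x + y \<in> R"
    and R_uminus: "x \<in> R \<Longrightarrow> - x \<in> R"
    and R_mult: "\<lbrakk>x \<in> R; y \<in> R\<rbrakk> \<Longrightarrow> x * y \<in> R"
begin

definition lideal :: "'r set \<Rightarrow> bool"
  where "lideal M \<longleftrightarrow> M \<subseteq> R \<and> 0 \<in> M \<and> (\<forall>x\<in>M. \<forall>y\<in>M. x + y \<in> M) \<and> (\<forall>x\<in>M. - x \<in> M)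
    \<and> (\<forall>a\<in>R. \<forall>x\<in>M. a * x \<in> M)"

definition min_lideal :: "'r set \<Rightarrow> bool"
  where "min_lideal M \<longleftrightarrow> lideal M \<and> M \<noteq> {0} \<and> (\<forall>M'. lideal M' \<and> M' \<subseteq> M \<longrightarrow> M' = {0} \<or> M' = M)"

lemma R_diff: "\<lbrakk>x \<in> R; y \<in> R\<rbrakk> \<Longrightarrow> x - y \<in> R"
  using R_add[of x "- y"] R_uminus[of y] by simp

lemma lidealD:
  assumes "lideal M"
  shows "x \<in> M \<Longrightarrow> x \<in> R" "0 \<in> M" "\<lbrakk>x \<in> M; y \<in> M\<rbrakk> \<Longrightarrow> x + y \<in> M" "x \<in> M \<Longrightarrow> - x \<in> M"
    "\<lbrakk>a \<in> R; x \<in> M\<rbrakk> \<Longrightarrow> a * x \<in> M"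
  using assms by (auto simp: lideal_def)

lemma min_lideal_lideal: "min_lideal M \<Longrightarrow> lideal M"
  by (simp add: min_lideal_def)

lemma min_lidealD: "\<lbrakk>min_lideal M; lideal M'; M' \<subseteq> M; y \<in> M'; y \<noteq> 0\<rbrakk> \<Longrightarrow> M' = M"
  by (auto simp: min_lideal_def)

lemma lideal_principal:
  assumes "y \<in> R"
  shows "lideal ((\<lambda>a. a * y) ` R)"
proof -
  have "0 \<in> (\<lambda>a. a * y) ` R"
    using R_zero by (intro image_eqI[of _ _ 0]) auto
  moreover have "a * y + b * y \<in> (\<lambda>a. a * y) ` R" if "a \<in> R" "b \<in> R" for a b
    using that by (intro image_eqI[of _ _ "a + b"]) (auto simp: distrib_right R_add)
  moreover have "- (a * y) \<in> (\<lambda>a. a * y) ` R" if "a \<in> R" for a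
    using that by (intro image_eqI[of _ _ "- a"]) (auto simp: R_uminus)
  moreover have "b * (a * y) \<in> (\<lambda>a. a * y) ` R" if "a \<in> R" "b \<in> R" for a b
    using that by (intro image_eqI[of _ _ "b * a"]) (auto simp: R_mult mult.assoc)
  ultimately show ?thesis
    using assms by (auto simp: lideal_def R_mult)
qed

text \<open>Since \<open>R\<close> may lack a unit, \<open>R y\<close> need not contain
  \<open>y\<close> and could even be 0. The element \<open>z\<close> with \<open>z * y = y\<close>
  puts \<open>y\<close> into it, and minimality then leaves only \<open>M\<close>.\<close>

lemma min_lideal_eq_principal:
  assumes "min_lideal M" "y \<in> M" "y \<noteq> 0" "z \<in> R" "z * y = y"
  shows "M = (\<lambda>a. a * y) ` R"
proof -
  note M = lidealD[OF min_lideal_lideal[OF assms(1)]]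
  have "y \<in> (\<lambda>a. a * y) ` R"
    using assms by (intro image_eqI[of _ _ z]) auto
  moreover have "(\<lambda>a. a * y) ` R \<subseteq> M"
    using M(5) assms(2) by auto
  ultimately show ?thesis
    using min_lidealD[OF assms(1) lideal_principal] M(1) assms(2,3) by blast
qed

text \<open>Schur's argument: the elements of \<open>M\<close> killed by \<open>n\<close> form a
  left ideal that misses \<open>x\<close>, hence is 0; and a left ideal inside \<open>M n\<close> is
  the image of its preimage in \<open>M\<close>, which is 0 or \<open>M\<close>.\<close>

lemma min_lideal_mult_right:
  assumes "min_lideal M" "n \<in> R" "x \<in> M" "x * n \<noteq> 0"
  shows "min_lideal ((\<lambda>x. x * n) ` M)" (is "min_lideal ?M'")
    and "\<And>y. \<lbrakk>y \<in> M; y * n = 0\<rbrakk> \<Longrightarrow> y = 0"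
proof -
  note M = lidealD[OF min_lideal_lideal[OF assms(1)]]
  have "lideal {y \<in> M. y * n = 0}"
    by (auto simp: lideal_def M distrib_right mult.assoc)
  then have "{y \<in> M. y * n = 0} = {0} \<or> {y \<in> M. y * n = 0} = M"
    using assms(1) unfolding min_lideal_def by blast
  then show "\<And>y. \<lbrakk>y \<in> M; y * n = 0\<rbrakk> \<Longrightarrow> y = 0"
    using assms(3,4) by blast
  have M': "lideal ?M'"
  proof -
    have "0 \<in> ?M'"
      using M(2) by (intro image_eqI[of _ _ 0]) auto
    moreover have "a * n + b * n \<in> ?M'" if "a \<in> M" "b \<in> M" for a b
      using that by (intro image_eqI[of _ _ "a + b"]) (auto simp: distrib_right M)
    moreover have "- (a * n) \<in> ?M'" if "a \<in> M" for a
      using that by (intro image_eqI[of _ _ "- a"]) (auto simp: M)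
    moreover have "b * (a * n) \<in> ?M'" if "a \<in> M" "b \<in> R" for a b
      using that by (intro image_eqI[of _ _ "b * a"]) (auto simp: M mult.assoc)
    ultimately show ?thesis
      using assms(2) M(1) by (auto simp: lideal_def R_mult)
  qed
  show "min_lideal ?M'"
    unfolding min_lideal_def
  proof (intro conjI allI impI)
    show "?M' \<noteq> {0}"
      using assms(3,4) by blast
    fix N assume N: "lideal N \<and> N \<subseteq> ?M'"
    note N' = lidealD[OF conjunct1[OF N]]
    have "lideal {y \<in> M. y * n \<in> N}"
      by (auto simp: lideal_def M N' distrib_right mult.assoc)
    then have "{y \<in> M. y * n \<in> N} = {0} \<or> {y \<in> M. y * n \<in> N} = M"
      using assms(1) unfolding min_lideal_def by blast
    moreover have "N = (\<lambda>x. x * n) ` {y \<in> M. y * n \<in> N}"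
      using N by auto
    ultimately show "N = {0} \<or> N = ?M'"
      by auto
  qed (rule M')
qed

end

section \<open>The action on infinite paths\<close>

text \<open>Transcendence of 1 + t in the form used below. The sum is P(1 + t) for a polynomial P
  with P(0) nonzero; the substitution x -> x + 1 is injective on polynomials, and polynomials embed
  into power series.\<close>

lemma fps_sum_list_powers_nonzero:
  fixes xs :: "('k::field \<times> nat) list"
  assumes "(\<Sum>(k, n)\<leftarrow>xs. if n = 0 then k else 0) \<noteq> 0"
  shows "(\<Sum>(k, n)\<leftarrow>xs. fps_const k * (1 + fps_X) ^ n) \<noteq> 0"
proof -
  define p where "p = (\<Sum>(k, n)\<leftarrow>xs. monom k n)"
  have "coeff p 0 = (\<Sum>(k, n)\<leftarrow>xs. if n = 0 then k else 0)"
    unfolding p_def by (induction xs) (auto split: if_splits)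
  then have "p \<noteq> 0"
    using assms by auto
  then have "pcompose p [:1, 1:] \<noteq> 0"
    by (simp add: pcompose_eq_0_iff)
  moreover have "pcompose (monom k n) [:1, 1:] = smult k ([:1, 1:] ^ n)" for k :: 'k and n
    by (induction n) (simp_all add: monom_0 monom_Suc pcompose_pCons)
  then have "fps_of_poly (pcompose p [:1, 1:]) = (\<Sum>(k, n)\<leftarrow>xs. fps_const k * (1 + fps_X) ^ n)"
    unfolding p_def
    by (induction xs)
      (auto simp: pcompose_add fps_of_poly_add fps_of_poly_smult fps_of_poly_power fps_of_poly_pCons add.commute)
  ultimately show ?thesis
    by (metis fps_of_poly_eq_iff fps_of_poly_0)
qed

lemma all_nat_Suc: "(\<forall>n. P n) \<longleftrightarrow> P 0 \<and> (\<forall>n. P (Suc n))"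
  using not0_implies_Suc by metis

text \<open>
  A letter \<open>Inl v\<close> is a virtual loop at a singular vertex \<open>v\<close>. With these loops every vertex is the
  source of an infinite path, while an infinite path from a regular vertex still starts with an edge,
  as CK2 demands. An edge prepends itself to a path and multiplies by the unit \<open>1 + t\<close> of \<open>K[[t]]\<close>,
  which records the length.
\<close>

context wf_digraph
begin

definition letter_tail :: "'a + 'b \<Rightarrow> 'a"
  where "letter_tail = case_sum id (tail G)"

definition letter_head :: "'a + 'b \<Rightarrow> 'a"
  where "letter_head = case_sum id (head G)"

definition inf_paths :: "(nat \<Rightarrow> 'a + 'b) set"
  where "inf_paths = {q. \<forall>n. q n \<in> Inl ` {v \<in> verts G. \<not> regular_vertex G v} \<union> Inr ` arcs G \<and>
    letter_tail (q (Suc n)) = letter_head (q n)}"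

definition source :: "(nat \<Rightarrow> 'a + 'b) \<Rightarrow> 'a"
  where "source q = letter_tail (q 0)"

primrec prepend :: "'b list \<Rightarrow> (nat \<Rightarrow> 'a + 'b) \<Rightarrow> nat \<Rightarrow> 'a + 'b" where
  "prepend [] q = q"
| "prepend (e # p) q = case_nat (Inr e) (prepend p q)"

definition act_vertex :: "'a \<Rightarrow> ((nat \<Rightarrow> 'a + 'b) \<Rightarrow> 'k::field fps) \<Rightarrow> (nat \<Rightarrow> 'a + 'b) \<Rightarrow> 'k fps"
  where "act_vertex v \<phi> q = (if q \<in> inf_paths \<and> source q = v then \<phi> q else 0)"

definition act_edge :: "'b \<Rightarrow> ((nat \<Rightarrow> 'a + 'b) \<Rightarrow> 'k::field fps) \<Rightarrow> (nat \<Rightarrow> 'a + 'b) \<Rightarrow> 'k fps"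
  where "act_edge e \<phi> q =
    (if q \<in> inf_paths \<and> q 0 = Inr e then (1 + fps_X) * \<phi> (\<lambda>n. q (Suc n)) else 0)"

text \<open>The factor \<open>inverse (1 + fps_X)\<close> cancels that of \<open>act_edge\<close>,
  as CK1 and CK2 require. The test \<open>e \<in> arcs G\<close>, which for \<open>act_edge\<close>
  follows from \<open>q \<in> inf_paths\<close>, makes a ghost letter outside the graph act as 0;
  the extension of the ideal to all words relies on this.\<close>

definition act_ghost :: "'b \<Rightarrow> ((nat \<Rightarrow> 'a + 'b) \<Rightarrow> 'k::field fps) \<Rightarrow> (nat \<Rightarrow> 'a + 'b) \<Rightarrow> 'k fps"
  where "act_ghost e \<phi> q =
    (if e \<in> arcs G \<and> q \<in> inf_paths \<and> source q = head G e
     then inverse (1 + fps_X) * \<phi> (case_nat (Inr e) q) else 0)"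

section \<open>Shifting, prepending and existence of infinite paths\<close>

lemma inf_paths_case_nat:
  "case_nat (Inr e) q \<in> inf_paths \<longleftrightarrow> e \<in> arcs G \<and> q \<in> inf_paths \<and> source q = head G e"
  unfolding inf_paths_def mem_Collect_eq
  by (subst all_nat_Suc) (auto simp: letter_tail_def letter_head_def source_def)

lemma source_case_nat [simp]: "source (case_nat (Inr e) q) = tail G e"
  by (simp add: source_def letter_tail_def)

lemma inf_paths_tl:
  assumes "q \<in> inf_paths"
  shows "(\<lambda>n. q (Suc n)) \<in> inf_paths"
  using assms by (auto simp: inf_paths_def)

lemma source_tl:
  assumes "q \<in> inf_paths" "q 0 = Inr e"
  shows "source (\<lambda>n. q (Suc n)) = head G e" "e \<in> arcs G" "source q = tail G e"
proof -
  have "q 0 \<in> Inl ` {v \<in> verts G. \<not> regular_vertex G v} \<union> Inr ` arcs G"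
    "letter_tail (q (Suc 0)) = letter_head (q 0)"
    using assms(1) unfolding inf_paths_def mem_Collect_eq by blast+
  then show "source (\<lambda>n. q (Suc n)) = head G e" "e \<in> arcs G" "source q = tail G e"
    using assms(2) by (auto simp: source_def letter_head_def letter_tail_def)
qed

lemma case_nat_tl: "case_nat (q 0) (\<lambda>n. q (Suc n)) = q"
  by (auto split: nat.split)

lemma case_nat_eq_iff: "p = case_nat x q \<longleftrightarrow> p 0 = x \<and> (\<lambda>n. p (Suc n)) = q"
  by (auto simp: fun_eq_iff split: nat.split)

lemma inf_paths_regular:
  assumes "q \<in> inf_paths" "regular_vertex G (source q)"
  obtains e where "q 0 = Inr e" "e \<in> out_arcs G (source q)"
proof -
  have "q 0 \<in> Inl ` {v \<in> verts G. \<not> regular_vertex G v} \<union> Inr ` arcs G"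
    using assms(1) by (auto simp: inf_paths_def)
  then show ?thesis
    using assms(2) that by (auto simp: source_def letter_tail_def)
qed

lemma prepend_inf_paths:
  assumes "awalk u p v" "q \<in> inf_paths" "source q = v"
  shows "prepend p q \<in> inf_paths \<and> source (prepend p q) = u"
  using assms by (induction p arbitrary: u) (auto simp: awalk_simps inf_paths_case_nat)

lemma prepend_append: "prepend (p @ p') q = prepend p (prepend p' q)"
  by (induction p) auto

lemma prepend_nth: "n < length p \<Longrightarrow> prepend p q n = Inr (p ! n)"
  by (induction p arbitrary: n) (auto split: nat.split)

lemma ex_inf_path:
  assumes "v \<in> verts G"
  obtains q where "q \<in> inf_paths" "source q = v"
proof -
  let ?L = "Inl ` {v \<in> verts G. \<not> regular_vertex G v} \<union> Inr ` arcs G :: ('a + 'b) set"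
  have "\<exists>x. x \<in> ?L \<and> letter_tail x = v \<and> letter_head x \<in> verts G" if "v \<in> verts G" for v
  proof (cases "regular_vertex G v")
    case True
    then obtain e where "e \<in> out_arcs G v"
      unfolding regular_vertex_def by blast
    then have "e \<in> arcs G" "tail G e = v"
      by auto
    then show ?thesis
      by (intro exI[of _ "Inr e"]) (auto simp: letter_tail_def letter_head_def)
  next
    case False
    then show ?thesis
      using that by (intro exI[of _ "Inl v"]) (auto simp: letter_tail_def letter_head_def)
  qed
  then have "\<exists>x. v \<in> verts G \<longrightarrow> x \<in> ?L \<and> letter_tail x = v \<and> letter_head x \<in> verts G" for v
    by blast
  then have "\<exists>pick. \<forall>v. v \<in> verts G \<longrightarrow> pick v \<in> ?L \<and> letter_tail (pick v) = v \<and> letter_head (pick v) \<in> verts G"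
    by (intro choice) blast
  then obtain pick where pick: "pick v \<in> ?L" "letter_tail (pick v) = v" "letter_head (pick v) \<in> verts G"
    if "v \<in> verts G" for v
    by blast
  \<comment> \<open>\<open>pick\<close> chooses one outgoing letter per vertex; following it from
    \<open>v\<close> visits the vertices \<open>w n\<close>.\<close>
  define w where "w n = ((letter_head \<circ> pick) ^^ n) v" for n
  have w: "w n \<in> verts G" for n
    by (induction n) (auto simp: w_def assms pick(3))
  have "letter_tail (pick (w (Suc n))) = letter_head (pick (w n))" for n
    using pick(2)[OF w, of "Suc n"] by (simp add: w_def)
  then have "(\<lambda>n. pick (w n)) \<in> inf_paths"
    using pick(1)[OF w] unfolding inf_paths_def by blast
  moreover have "source (\<lambda>n. pick (w n)) = v"
    using pick(2)[OF assms] by (simp add: source_def w_def)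
  ultimately show ?thesis
    by (rule that)
qed

lemma ex_periodic_path:
  assumes "awalk v p v" "p \<noteq> []"
  obtains q where "q \<in> inf_paths" "source q = v" "prepend p q = q"
proof -
  define m where "m = length p"
  have m: "m > 0"
    using assms(2) by (simp add: m_def)
  define q :: "nat \<Rightarrow> 'a + 'b" where "q n = Inr (p ! (n mod m))" for n
  have head_nth: "\<lbrakk>cas u p w; Suc n < length p\<rbrakk> \<Longrightarrow> tail G (p ! Suc n) = head G (p ! n)" for n p u w
    by (induction p arbitrary: u n) (auto simp: nth_Cons neq_Nil_conv cas_simp split: nat.split)
  have head_last: "\<lbrakk>cas u p w; p \<noteq> []\<rbrakk> \<Longrightarrow> head G (p ! (length p - 1)) = w" for p u w
  proof (induction p arbitrary: u)
    case (Cons e p)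
    then show ?case
      by (cases p) auto
  qed simp
  have cas: "cas v p v" and arcs: "set p \<subseteq> arcs G"
    using assms(1) by (auto simp: awalk_def)
  have tail0: "tail G (p ! 0) = v"
    using cas assms(2) by (cases p) auto
  \<comment> \<open>The two cases are the wrap-around from the last edge to the first, where
    closedness of \<open>p\<close> enters, and the interior indices.\<close>
  have "tail G (p ! (Suc n mod m)) = head G (p ! (n mod m))" for n
  proof (cases "Suc (n mod m) = m")
    case True
    then have "n mod m = length p - 1"
      by (simp add: m_def)
    then show ?thesis
      using head_last[OF cas assms(2)] tail0 True by (simp add: mod_Suc)
  next
    case False
    then have "Suc (n mod m) < length p"
      using m by (metis Suc_lessI m_def mod_less_divisor)
    then show ?thesis
      using head_nth[OF cas] False by (simp add: mod_Suc)
  qed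
  then have "q \<in> inf_paths"
    using m arcs by (auto simp: inf_paths_def q_def letter_head_def letter_tail_def m_def
        subset_iff)
  moreover have "source q = v"
    using tail0 by (simp add: source_def q_def letter_tail_def)
  moreover have "prepend p q = q"
  proof
    fix n
    have "prepend p' q n = (if n < length p' then Inr (p' ! n) else q (n - length p'))" for p'
      by (induction p' arbitrary: n) (auto split: nat.split)
    then show "prepend p q n = q n"
      by (auto simp: q_def m_def le_mod_geq)
  qed
  ultimately show ?thesis
    by (rule that)
qed

end

section \<open>Leavitt families\<close>

text \<open>Products grow by one generator at a time on the right, so that inductions follow the
  last letter of a word. This suits right local units and the bookkeeping of ghost edges; closure
  under all products is then proved by induction on the right factor.\<close>

inductive_set subalgebra :: "('k \<Rightarrow> 'r::ring \<Rightarrow> 'r) \<Rightarrow> 'r set \<Rightarrow> 'r set"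
  for scale S where
  generator: "g \<in> S \<Longrightarrow> g \<in> subalgebra scale S"
| zero: "0 \<in> subalgebra scale S"
| add: "\<lbrakk>x \<in> subalgebra scale S; y \<in> subalgebra scale S\<rbrakk> \<Longrightarrow> x + y \<in> subalgebra scale S"
| scale: "x \<in> subalgebra scale S \<Longrightarrow> scale k x \<in> subalgebra scale S"
| mult: "\<lbrakk>x \<in> subalgebra scale S; g \<in> S\<rbrakk> \<Longrightarrow> x * g \<in> subalgebra scale S"

text \<open>The interface between the algebra and its representation: a set \<open>R\<close>
  generated by elements that satisfy the Leavitt relations, and a multiplicative action of
  \<open>R\<close> on functions of infinite paths that commutes with power series scalars.
  Reductions come from the relations, nonvanishing from the action.\<close>

locale leavitt_family = wf_digraph G for G :: "('a, 'b) pre_digraph" +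
  fixes scale :: "'k::field \<Rightarrow> 'r::ring \<Rightarrow> 'r"
    and V :: "'a \<Rightarrow> 'r" and X Y :: "'b \<Rightarrow> 'r" and R :: "'r set"
    and act :: "'r \<Rightarrow> ((nat \<Rightarrow> 'a + 'b) \<Rightarrow> 'k fps) \<Rightarrow> (nat \<Rightarrow> 'a + 'b) \<Rightarrow> 'k fps"
  assumes scale_add: "scale k (x + y) = scale k x + scale k y"
    and scale_add_left: "scale (k + l) x = scale k x + scale l x"
    and scale_scale: "scale k (scale l x) = scale (k * l) x"
    and scale_one: "scale 1 x = x"
    and mult_scale_left: "scale k x * y = scale k (x * y)"
    and mult_scale_right: "x * scale k y = scale k (x * y)"
    and R_eq: "R = subalgebra scale (V ` verts G \<union> X ` arcs G \<union> Y ` arcs G)"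
    and V_V: "\<lbrakk>u \<in> verts G; w \<in> verts G\<rbrakk> \<Longrightarrow> V u * V w = (if u = w then V u else 0)"
    and V_X: "e \<in> arcs G \<Longrightarrow> V (tail G e) * X e = X e"
    and X_V: "e \<in> arcs G \<Longrightarrow> X e * V (head G e) = X e"
    and V_Y: "e \<in> arcs G \<Longrightarrow> V (head G e) * Y e = Y e"
    and Y_V: "e \<in> arcs G \<Longrightarrow> Y e * V (tail G e) = Y e"
    and Y_X: "\<lbrakk>e \<in> arcs G; f \<in> arcs G\<rbrakk> \<Longrightarrow> Y e * X f = (if e = f then V (head G e) else 0)"
    and CK2: "regular_vertex G u \<Longrightarrow> V u = (\<Sum>e \<in> out_arcs G u. X e * Y e)"
    and act_add: "\<lbrakk>x \<in> R; y \<in> R\<rbrakk> \<Longrightarrow> act (x + y) \<phi> q = act x \<phi> q + act y \<phi> q"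
    and act_scale: "x \<in> R \<Longrightarrow> act (scale k x) \<phi> q = fps_const k * act x \<phi> q"
    and act_mult: "\<lbrakk>x \<in> R; y \<in> R\<rbrakk> \<Longrightarrow> act (x * y) \<phi> = act x (act y \<phi>)"
    and act_linear: "x \<in> R \<Longrightarrow> act x (\<lambda>p. c * \<phi> p) q = c * act x \<phi> q"
    and act_V: "v \<in> verts G \<Longrightarrow> act (V v) = act_vertex v"
    and act_X: "e \<in> arcs G \<Longrightarrow> act (X e) = act_edge e"
begin

section \<open>Scalars and local units\<close>

lemma scale_0_left [simp]: "scale 0 x = 0"
  using scale_add_left[of 0 0 x] by simp

lemma scale_0_right [simp]: "scale k 0 = 0"
  using scale_add[of k 0 0] by simp

lemma scale_minus_one: "scale (- 1) x = - x"
  using scale_add_left[of 1 "- 1" x] by (simp add: scale_one eq_neg_iff_add_eq_0 add.commute)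

lemma V_R: "v \<in> verts G \<Longrightarrow> V v \<in> R"
  and X_R: "e \<in> arcs G \<Longrightarrow> X e \<in> R"
  and Y_R: "e \<in> arcs G \<Longrightarrow> Y e \<in> R"
  by (auto simp: R_eq intro: subalgebra.generator)

lemma scale_R: "x \<in> R \<Longrightarrow> scale k x \<in> R"
  by (auto simp: R_eq intro: subalgebra.scale)

sublocale subrng R
proof
  show "0 \<in> R"
    by (simp add: R_eq subalgebra.zero)
  show add: "x + y \<in> R" if "x \<in> R" "y \<in> R" for x y
    using that by (simp add: R_eq subalgebra.add)
  show "- x \<in> R" if "x \<in> R" for x
    using scale_R[OF that, of "- 1"] by (simp add: scale_minus_one)
  show "x * y \<in> R" if "x \<in> R" "y \<in> R" for x y
    using that(2)[unfolded R_eq]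
  proof (induction y rule: subalgebra.induct)
    case (mult y g)
    then show ?case
      by (simp add: R_eq subalgebra.mult flip: mult.assoc)
  qed (use that in \<open>auto simp: R_eq distrib_left mult_scale_right
      intro: subalgebra.intros\<close>)
qed

lemma act_0 [simp]: "act 0 \<phi> q = 0"
  using act_add[OF R_zero R_zero, of \<phi> q] by (metis add_0 add_cancel_right_right)

lemma right_local_unit:
  assumes "x \<in> R"
  obtains F where "finite F" "F \<subseteq> verts G" "x * sum V F = x"
proof -
  \<comment> \<open>Quantifying over all larger finite sets makes the property survive enlargement
    of \<open>F\<close>, so that a union serves for the sum of two elements.\<close>
  define unit where "unit x F \<longleftrightarrow> finite F \<and> F \<subseteq> verts G \<and>
    (\<forall>F'. finite F' \<and> F \<subseteq> F' \<and> F' \<subseteq> verts G \<longrightarrow> x * sum V F' = x)" for x F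
  have unit_right: "unit g {v}" if "v \<in> verts G" "g * V v = g" for g v
  proof -
    have "g * sum V F' = g" if F': "finite F'" "{v} \<subseteq> F'" "F' \<subseteq> verts G" for F'
    proof -
      have "g * sum V F' = (\<Sum>w\<in>F'. g * V v * V w)"
        by (simp add: sum_distrib_left \<open>g * V v = g\<close>)
      also have "\<dots> = (\<Sum>w\<in>F'. if w = v then g * V v else 0)"
        using \<open>v \<in> verts G\<close> F' by (intro sum.cong) (auto simp: V_V mult.assoc)
      finally show ?thesis
        using F' \<open>g * V v = g\<close> by simp
    qed
    then show ?thesis
      using \<open>v \<in> verts G\<close> by (simp add: unit_def)
  qed
  have gen: "\<exists>v. unit (x * g) {v} \<and> unit g {v}" if g: "g \<in> V ` verts G \<union> X ` arcs G \<union> Y ` arcs G" for x g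
  proof -
    consider v where "v \<in> verts G" "g = V v" | e where "e \<in> arcs G" "g = X e" | e where "e \<in> arcs G" "g = Y e"
      using g by blast
    then obtain v where "v \<in> verts G" "g * V v = g"
    proof cases
      case (1 v)
      then show ?thesis
        using V_V that by simp
    next
      case (2 e)
      then show ?thesis
        using X_V[of e] that head_in_verts[of e] by metis
    next
      case (3 e)
      then show ?thesis
        using Y_V[of e] that tail_in_verts[of e] by metis
    qed
    then show ?thesis
      using unit_right[of v g] unit_right[of v "x * g"] by (auto simp: mult.assoc)
  qed
  have "\<exists>F. unit x F"
    using assms unfolding R_eq
  proof (induction rule: subalgebra.induct)
    case (generator g)
    show ?case
      using gen[OF generator] by auto
  next
    case (mult x g)
    show ?case
      using gen[OF mult.hyps(2)] by auto
  next
    case zero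
    have "unit 0 {}"
      by (simp add: unit_def)
    then show ?case ..
  next
    case (add x y)
    then obtain F F' where "unit x F" "unit y F'"
      by auto
    then have "unit (x + y) (F \<union> F')"
      by (simp add: unit_def distrib_right)
    then show ?case ..
  next
    case (scale x k)
    then obtain F where "unit x F"
      by auto
    then have "unit (scale k x) F"
      by (simp add: unit_def mult_scale_left)
    then show ?case ..
  qed
  then show ?thesis
    using that by (auto simp: unit_def)
qed

lemma ex_mult_V_nonzero:
  assumes "x \<in> R" "x \<noteq> 0"
  obtains v where "v \<in> verts G" "x * V v \<noteq> 0"
proof -
  obtain F where "finite F" "F \<subseteq> verts G" "x * sum V F = x"
    using right_local_unit[OF assms(1)] by metis
  then have "(\<Sum>v\<in>F. x * V v) \<noteq> 0"
    using assms(2) by (simp add: sum_distrib_left)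
  then obtain v where "v \<in> F" "x * V v \<noteq> 0"
    using sum.not_neutral_contains_not_neutral by blast
  then show ?thesis
    using \<open>F \<subseteq> verts G\<close> that by blast
qed


subsection \<open>Paths\<close>

text \<open>An edge list does not tell where the empty path sits, so the end vertex \<open>v\<close>
  is carried along. In \<open>ghost\<close> the same \<open>v\<close> is the end of the underlying
  real path: if \<open>path v p\<close> is p, then \<open>ghost v p\<close> is p^*.\<close>

primrec path :: "'a \<Rightarrow> 'b list \<Rightarrow> 'r" where
  "path v [] = V v"
| "path v (e # p) = X e * path v p"

primrec ghost :: "'a \<Rightarrow> 'b list \<Rightarrow> 'r" where
  "ghost v [] = V v"
| "ghost v (e # p) = ghost v p * Y e"

lemma V_path:
  assumes "awalk u p v" "w \<in> verts G"
  shows "V w * path v p = (if w = u then path v p else 0)"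
proof (cases p)
  case Nil
  then show ?thesis
    using assms by (auto simp: awalk_simps V_V)
next
  case (Cons e p')
  then have e: "e \<in> arcs G" "tail G e = u"
    using assms by (auto simp: awalk_simps)
  then have "V w * X e = (if w = u then X e else 0)"
    using V_X[OF e(1)] V_V[OF assms(2) tail_in_verts[OF e(1)]] by (metis mult.assoc mult_zero_left)
  then show ?thesis
    using Cons by (simp flip: mult.assoc)
qed

lemma path_V:
  assumes "awalk u p v"
  shows "path v p * V v = path v p"
  using assms by (induction p arbitrary: u) (auto simp: awalk_simps V_V mult.assoc)

lemma path_R: "awalk u p v \<Longrightarrow> path v p \<in> R"
  by (induction p arbitrary: u) (auto simp: awalk_simps V_R X_R R_mult)

lemma ghost_R: "awalk u p v \<Longrightarrow> ghost v p \<in> R"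
  by (induction p arbitrary: u) (auto simp: awalk_simps V_R Y_R R_mult)

lemma path_append:
  assumes "awalk u p v" "awalk v p' w"
  shows "path v p * path w p' = path w (p @ p')"
  using assms by (induction p arbitrary: u) (auto simp: awalk_simps V_path mult.assoc)

lemma path_X:
  assumes "awalk u p (tail G f)" "f \<in> arcs G"
  shows "path (tail G f) p * X f = path (head G f) (p @ [f])"
  using path_append[OF assms(1), of "[f]" "head G f"] assms(2) by (simp add: awalk_simps X_V)

lemma Y_path:
  assumes "e \<in> arcs G" "awalk u (f # p) v"
  shows "Y e * path v (f # p) = (if e = f then path v p else 0)"
proof -
  have "f \<in> arcs G" "awalk (head G f) p v"
    using assms by (auto simp: awalk_simps)
  then show ?thesis
    using assms(1) V_path[of "head G f" p v "head G f"] by (simp add: Y_X flip: mult.assoc)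
qed

text \<open>CK1 cancels edge against edge. As \<open>p\<close> is not longer than \<open>p'\<close>,
  the ghost path is used up, and a real path or 0 remains. Comparing the sources matters for empty
  \<open>p\<close>, where the prefix condition is void.\<close>

lemma ghost_path:
  assumes "awalk u p v" "awalk u' p' w" "length p \<le> length p'"
  shows "ghost v p * path w p' = (if u = u' \<and> take (length p) p' = p then path w (drop (length p) p') else 0)"
  using assms
proof (induction p arbitrary: u u' p')
  case Nil
  then show ?case
    by (auto simp: awalk_simps V_path)
next
  case (Cons e p)
  then obtain f p'' where p': "p' = f # p''"
    by (cases p') auto
  have e: "e \<in> arcs G" "u = tail G e" "awalk (head G e) p v"
    using Cons.prems by (auto simp: awalk_simps)
  have f: "u' = tail G f" "awalk (head G f) p'' w"
    using Cons.prems by (auto simp: awalk_simps p')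
  have "ghost v (e # p) * path w p' = ghost v p * (Y e * path w p')"
    by (simp add: mult.assoc)
  also have "\<dots> = ghost v p * (if e = f then path w p'' else 0)"
    using Y_path[OF e(1), of u' f p'' w] Cons.prems(2) by (simp add: p')
  also have "\<dots> = (if e = f then ghost v p * path w p'' else 0)"
    by simp
  finally show ?case
    using Cons.IH[OF e(3) f(2)] Cons.prems(3) e f by (auto simp: p')
qed

lemma ghost_path_same: "awalk u p v \<Longrightarrow> ghost v p * path v p = V v"
  using ghost_path[of u p v u p v] by simp


subsection \<open>Sums of paths\<close>

text \<open>A combination of real paths is represented by a list, possibly with repeated paths or
  zero coefficients. Constant coefficient and weight are attributes of the list, not of the element
  that it represents.\<close>

definition paths_to :: "'a \<Rightarrow> ('k \<times> 'b list) list \<Rightarrow> bool"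
  where "paths_to v xs \<longleftrightarrow> v \<in> verts G \<and> (\<forall>(k, p) \<in> set xs. \<exists>u. awalk u p v)"

definition path_sum :: "'a \<Rightarrow> ('k \<times> 'b list) list \<Rightarrow> 'r"
  where "path_sum v xs = (\<Sum>(k, p)\<leftarrow>xs. scale k (path v p))"

definition const_coeff :: "('k \<times> 'b list) list \<Rightarrow> 'k"
  where "const_coeff xs = (\<Sum>(k, p)\<leftarrow>xs. if p = [] then k else 0)"

text \<open>The \<open>Suc\<close> makes the loss of any term, even of an empty path, lower the
  measure; shortening a path lowers it too.\<close>

definition weight :: "('k \<times> 'b list) list \<Rightarrow> nat"
  where "weight xs = (\<Sum>(k, p)\<leftarrow>xs. Suc (length p))"

lemma paths_to_Nil [simp]: "paths_to v [] \<longleftrightarrow> v \<in> verts G"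
  and paths_to_Cons [simp]: "paths_to v ((k, p) # xs) \<longleftrightarrow> (\<exists>u. awalk u p v) \<and> paths_to v xs"
  and paths_to_append [simp]: "paths_to v (xs @ ys) \<longleftrightarrow> paths_to v xs \<and> paths_to v ys"
  unfolding paths_to_def set_append ball_Un by auto

lemma path_sum_Nil [simp]: "path_sum v [] = 0"
  and path_sum_Cons [simp]: "path_sum v ((k, p) # xs) = scale k (path v p) + path_sum v xs"
  and path_sum_append [simp]: "path_sum v (xs @ ys) = path_sum v xs + path_sum v ys"
  by (auto simp: path_sum_def)

lemma const_coeff_Nil [simp]: "const_coeff [] = 0"
  and const_coeff_Cons [simp]: "const_coeff ((k, p) # xs) = (if p = [] then k else 0) + const_coeff xs"
  by (auto simp: const_coeff_def)

lemma weight_Nil [simp]: "weight [] = 0"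
  and weight_Cons [simp]: "weight ((k, p) # xs) = Suc (length p) + weight xs"
  by (auto simp: weight_def)

lemma path_sum_R: "paths_to v xs \<Longrightarrow> path_sum v xs \<in> R"
  by (induction xs) (auto simp: R_zero path_R intro!: R_add scale_R)

lemma path_sum_V: "paths_to v xs \<Longrightarrow> path_sum v xs * V v = path_sum v xs"
  by (induction xs) (auto simp: distrib_right mult_scale_left path_V)

lemma path_sum_X:
  assumes "paths_to v xs" "f \<in> out_arcs G v"
  shows "path_sum v xs * X f = path_sum (head G f) (map (\<lambda>(k, p). (k, p @ [f])) xs)"
    and "paths_to (head G f) (map (\<lambda>(k, p). (k, p @ [f])) xs)"
proof -
  have f: "f \<in> arcs G" "tail G f = v"
    using assms(2) by auto
  show "path_sum v xs * X f = path_sum (head G f) (map (\<lambda>(k, p). (k, p @ [f])) xs)"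
    using assms(1) f by (induction xs) (auto simp: distrib_right mult_scale_left path_X)
  show "paths_to (head G f) (map (\<lambda>(k, p). (k, p @ [f])) xs)"
  proof (use assms(1) in \<open>induction xs\<close>)
    case Nil
    then show ?case
      using f by auto
  next
    case (Cons x xs)
    then obtain k p u where "x = (k, p)" "awalk u p v"
      by (cases x) auto
    moreover from this have "awalk u (p @ [f]) (head G f)"
      using f by (intro awalk_appendI[of u p v]) (auto simp: awalk_simps)
    ultimately show ?case
      using Cons by (auto simp del: awalk_append_iff)
  qed
qed

text \<open>By CK1, e^* keeps exactly the terms that begin with \<open>e\<close> and strips that
  edge. All terms having positive length, each one loses at least 1 of its weight, so a nonempty
  list gets lighter.\<close>

lemma Y_path_sum:
  assumes "e \<in> arcs G" "paths_to v xs" "\<forall>(k, p) \<in> set xs. p \<noteq> []"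
  defines "ys \<equiv> map (\<lambda>(k, p). (k, tl p)) (filter (\<lambda>(k, p). hd p = e) xs)"
  shows "Y e * path_sum v xs = path_sum v ys" "paths_to v ys" "xs \<noteq> [] \<Longrightarrow> weight ys < weight xs"
proof -
  show "Y e * path_sum v xs = path_sum v ys"
    unfolding ys_def using assms(2,3)
  proof (induction xs)
    case (Cons x xs)
    obtain k f p where x: "x = (k, f # p)"
      using Cons.prems by (cases x; cases "snd x") auto
    then obtain u where "awalk u (f # p) v"
      using Cons.prems by auto
    then show ?case
      using Cons Y_path[OF assms(1)] by (auto simp: x distrib_left mult_scale_right)
  qed simp
  show "paths_to v ys"
    unfolding ys_def using assms(2,3)
  proof (induction xs)
    case (Cons x xs)
    obtain k f p where x: "x = (k, f # p)"
      using Cons.prems by (cases x; cases "snd x") auto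
    then show ?case
      using Cons by (auto simp: awalk_simps)
  qed simp
  have "weight ys + length xs \<le> weight xs"
    unfolding ys_def using assms(3) by (induction xs) auto
  then show "weight ys < weight xs" if "xs \<noteq> []"
    using that by (cases xs) auto
qed

text \<open>On paths whose first edge lies in \<open>F\<close>, the sum of e e^* over
  \<open>F\<close> acts from the left as a unit by CK1, even at vertices that emit infinitely many
  edges. Hence a nonzero sum of such paths stays nonzero under some e^*.\<close>

lemma path_sum_eq_sum_X_Y:
  assumes "paths_to v xs" "\<forall>(k, p) \<in> set xs. p \<noteq> []"
    "finite F" "F \<subseteq> arcs G" "\<forall>(k, p) \<in> set xs. hd p \<in> F"
  shows "path_sum v xs = (\<Sum>e\<in>F. X e * (Y e * path_sum v xs))"
  using assms(1,2,5)
proof (induction xs)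
  case (Cons x xs)
  obtain k f p where x: "x = (k, f # p)"
    using Cons.prems by (cases x; cases "snd x") auto
  then obtain u where "awalk u (f # p) v"
    using Cons.prems by auto
  then have "(\<Sum>e\<in>F. X e * (Y e * path v (f # p))) = (\<Sum>e\<in>F. if e = f then X e * path v p else 0)"
    using assms(4) by (intro sum.cong) (auto simp: Y_path simp del: path.simps)
  also have "\<dots> = path v (f # p)"
    using Cons.prems assms(3) by (simp add: x)
  finally have f: "(\<Sum>e\<in>F. X e * (Y e * path v (f # p))) = path v (f # p)" .
  have "(\<Sum>e\<in>F. X e * (Y e * scale k (path v (f # p)))) = scale k (\<Sum>e\<in>F. X e * (Y e * path v (f # p)))"
    by (induction F rule: infinite_finite_induct) (simp_all add: mult_scale_right scale_add)
  moreover have "path_sum v xs = (\<Sum>e\<in>F. X e * (Y e * path_sum v xs))"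
    using Cons.IH Cons.prems by (simp add: x)
  ultimately show ?case
    using f by (simp add: x distrib_left sum.distrib del: path.simps)
qed simp

text \<open>The list representing p^* y p. A closed term \<open>q\<close> survives if
  \<open>q p\<close> begins with \<open>p\<close>, and what is left of it has again the length of
  \<open>q\<close>.\<close>

definition conjugate :: "'a \<Rightarrow> 'b list \<Rightarrow> ('k \<times> 'b list) list \<Rightarrow> ('k \<times> 'b list) list"
  where "conjugate v p xs = map (\<lambda>(k, q). (k, drop (length p) (q @ p)))
    (filter (\<lambda>(k, q). awalk v q v \<and> take (length p) (q @ p) = p) xs)"

lemma conjugate_Nil [simp]: "conjugate v p [] = []"
  and conjugate_Cons: "conjugate v p ((k, q) # xs) =
    (if awalk v q v \<and> take (length p) (q @ p) = p then [(k, drop (length p) (q @ p))] else [])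
    @ conjugate v p xs"
  by (auto simp: conjugate_def)

text \<open>Survivors keep their length, and empty terms stay empty because p^* p is the end vertex
  of \<open>p\<close>. So the constant coefficient is preserved, and the weight drops as soon as a
  term is lost.\<close>

lemma conjugate:
  assumes "awalk v p w" "paths_to v xs"
  shows "ghost w p * path_sum v xs * path w p = path_sum w (conjugate v p xs)"
    and "paths_to w (conjugate v p xs)"
    and "const_coeff (conjugate v p xs) = const_coeff xs"
    and "weight (conjugate v p xs) \<le> weight xs"
    and "\<lbrakk>(k, q) \<in> set xs; \<not> (awalk v q v \<and> take (length p) (q @ p) = p)\<rbrakk>
      \<Longrightarrow> weight (conjugate v p xs) < weight xs"
proof -
  have v: "v \<in> verts G" and w: "w \<in> verts G"
    using assms(1) by (auto intro: awalk_hd_in_verts awalk_last_in_verts)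
  show "ghost w p * path_sum v xs * path w p = path_sum w (conjugate v p xs)"
    using assms(2)
  proof (induction xs)
    case (Cons x xs)
    obtain k q where x: "x = (k, q)"
      by (cases x)
    then obtain u where u: "awalk u q v"
      using Cons.prems by auto
    have "awalk v q v \<longleftrightarrow> u = v"
      using u awalk_ends by blast
    moreover have "ghost w p * path v q * path w p = ghost w p * path w (q @ p)"
      by (simp add: mult.assoc path_append[OF u assms(1)])
    moreover have "ghost w p * path w (q @ p) =
        (if v = u \<and> take (length p) (q @ p) = p then path w (drop (length p) (q @ p)) else 0)"
      by (rule ghost_path[OF assms(1) awalk_appendI[OF u assms(1)]]) simp
    ultimately show ?case
      using Cons by (auto simp: x conjugate_Cons distrib_left distrib_right mult_scale_left mult_scale_right
          simp del: drop_append take_append)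
  qed simp
  show "paths_to w (conjugate v p xs)"
  proof -
    have "\<exists>u. awalk u (drop (length p) (q @ p)) w" if "awalk v q v" "take (length p) (q @ p) = p" for q
    proof -
      have "awalk v (q @ p) w"
        using that(1) assms(1) by (rule awalk_appendI)
      then have "awalk v (take (length p) (q @ p) @ drop (length p) (q @ p)) w"
        by (simp only: append_take_drop_id)
      then show ?thesis
        unfolding awalk_append_iff by blast
    qed
    then show ?thesis
      using w by (auto simp: conjugate_def paths_to_def simp del: drop_append take_append)
  qed
  show "const_coeff (conjugate v p xs) = const_coeff xs"
    using v by (induction xs) (auto simp: conjugate_Cons awalk_simps)
  show "weight (conjugate v p xs) \<le> weight xs"
    by (induction xs) (auto simp: conjugate_Cons)
  then show "weight (conjugate v p xs) < weight xs"
    if "(k, q) \<in> set xs" "\<not> (awalk v q v \<and> take (length p) (q @ p) = p)"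
    using that
  proof (induction xs)
    case (Cons x xs)
    have le: "weight (conjugate v p ys) \<le> weight ys" for ys
      by (induction ys) (auto simp: conjugate_Cons)
    show ?case
    proof (cases "x = (k, q)")
      case True
      then have "conjugate v p (x # xs) = conjugate v p xs"
        using Cons.prems(3) by (simp add: conjugate_Cons)
      then show ?thesis
        using le[of xs] True by simp
    next
      case False
      then have "weight (conjugate v p xs) < weight xs"
        using Cons le by auto
      then show ?thesis
        by (cases x) (auto simp: conjugate_Cons)
    qed
  qed simp
qed


subsection \<open>Elements that act nontrivially\<close>

definition delta :: "(nat \<Rightarrow> 'a + 'b) \<Rightarrow> (nat \<Rightarrow> 'a + 'b) \<Rightarrow> 'k fps"
  where "delta q = (\<lambda>p. if p = q then 1 else 0)"

lemma act_path:
  assumes "awalk u p v" "q \<in> inf_paths" "source q = v"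
  shows "act (path v p) (delta q) r = (if r = prepend p q then (1 + fps_X) ^ length p else 0)"
  using assms
proof (induction p arbitrary: u r)
  case Nil
  then show ?case
    by (auto simp: awalk_simps act_V act_vertex_def delta_def)
next
  case (Cons e p)
  then have e: "e \<in> arcs G" "awalk (head G e) p v" "u = tail G e"
    by (auto simp: awalk_simps)
  have "case_nat (Inr e) (prepend p q) \<in> inf_paths"
    using prepend_inf_paths[OF e(2) Cons.prems(2,3)] e(1) by (simp add: inf_paths_case_nat)
  then have "r \<in> inf_paths" if "r 0 = Inr e" "(\<lambda>n. r (Suc n)) = prepend p q"
    using that case_nat_eq_iff by metis
  then show ?case
    using Cons.IH[OF e(2) Cons.prems(2,3)] e
    by (auto simp: act_mult X_R path_R act_X act_edge_def case_nat_eq_iff)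
qed

lemma act_path_sum:
  assumes "paths_to v xs" "q \<in> inf_paths" "source q = v"
  shows "act (path_sum v xs) (delta q) r =
    (\<Sum>(k, p)\<leftarrow>xs. fps_const k * (if r = prepend p q then (1 + fps_X) ^ length p else 0))"
  using assms(1)
proof (induction xs)
  case (Cons x xs)
  then show ?case
    using act_path[OF _ assms(2,3)]
    by (cases x) (auto simp: act_add act_scale path_R path_sum_R scale_R)
qed simp

text \<open>Takes the place of linear independence of paths. The image of the indicator of
  \<open>q\<close> has at \<open>q\<close> the value sum of k (1 + t)^n over the terms with
  \<open>prepend p q = q\<close>, where n is the length of \<open>p\<close>. The empty terms are all
  among them and are the only ones with n = 0, so this is a polynomial in 1 + t with constant
  coefficient \<open>const_coeff xs\<close>.\<close>

lemma path_sum_nonzero: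
  assumes "paths_to v xs" "const_coeff xs \<noteq> 0"
  shows "path_sum v xs \<noteq> 0"
proof
  assume *: "path_sum v xs = 0"
  obtain q where q: "q \<in> inf_paths" "source q = v"
    using assms(1) ex_inf_path by (auto simp: paths_to_def)
  define ys where "ys = map (\<lambda>(k, p). (k, length p)) (filter (\<lambda>(k, p). q = prepend p q) xs)"
  have "(\<Sum>(k, n)\<leftarrow>ys. if n = 0 then k else 0) = const_coeff xs"
    unfolding ys_def by (induction xs) auto
  moreover have "(\<Sum>(k, n)\<leftarrow>ys. fps_const k * (1 + fps_X) ^ n) = act (path_sum v xs) (delta q) q"
    unfolding act_path_sum[OF assms(1) q] ys_def by (induction xs) auto
  ultimately show False
    using fps_sum_list_powers_nonzero[of ys] assms(2) * by simp
qed

lemma V_nonzero: "v \<in> verts G \<Longrightarrow> V v \<noteq> 0"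
  using path_sum_nonzero[of v "[(1, [])]"] by (auto simp: scale_one awalk_simps)

text \<open>
  If \<open>y\<close> acts on the indicator of \<open>q = p q\<close> as the scalar \<open>r\<close>, then \<open>w = (v - p) y\<close> acts as
  \<open>r (1 - (1 + t) ^ length p)\<close>, and \<open>y = a w\<close> would make \<open>1 - (1 + t) ^ length p\<close> a unit.
\<close>

lemma not_min_lideal_if_eigenvector:
  assumes "min_lideal M" "y \<in> M" "q \<in> inf_paths" "source q = v" "awalk v p v" "p \<noteq> []"
    and "prepend p q = q" "\<And>s. act y (delta q) s = r * delta q s" "r \<noteq> 0"
  shows False
proof -
  note M = lidealD[OF min_lideal_lideal[OF assms(1)]]
  define c :: "'k fps" where "c = 1 - (1 + fps_X) ^ length p"
  \<comment> \<open>\<open>c\<close> is the value of 1 - x^n at x = 1 + t. It is nonzero because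
    that polynomial is 1 at x = 0, while its constant term in t is 0 because the polynomial vanishes
    at x = 1.\<close>
  have c: "c \<noteq> 0"
    using fps_sum_list_powers_nonzero[of "[(1 :: 'k, 0), (- 1, length p)]"] assms(6)
    by (auto simp: c_def simp flip: fps_const_neg)
  define z where "z = V v - path v p"
  have v: "v \<in> verts G"
    using assms(5) by (rule awalk_hd_in_verts)
  have z: "z \<in> R"
    unfolding z_def by (intro R_diff V_R v path_R[OF assms(5)])
  have y: "act y (delta q) = (\<lambda>s. r * delta q s)"
    using assms(8) by blast
  have "act (V v) (delta q) s = act z (delta q) s + act (path v p) (delta q) s" for s
    using act_add[OF z path_R[OF assms(5)], of "delta q" s] by (simp add: z_def)
  moreover have "act (V v) (delta q) s = delta q s" for s
    using assms(3,4) v by (auto simp: act_V act_vertex_def delta_def)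
  moreover have "act (path v p) (delta q) s = (1 + fps_X) ^ length p * delta q s" for s
    using act_path[OF assms(5,3,4)] assms(7) by (simp add: delta_def)
  ultimately have "act z (delta q) s = c * delta q s" for s
    by (simp add: c_def left_diff_distrib eq_diff_eq)
  then have w: "act (z * y) (delta q) = (\<lambda>s. r * c * delta q s)"
    by (simp add: act_mult[OF z M(1)[OF assms(2)]] y act_linear[OF z] mult.assoc fun_eq_iff)
  have "z * y \<noteq> 0"
  proof
    assume "z * y = 0"
    then have "r * c * delta q q = 0"
      using fun_cong[OF w, of q] by simp
    then show False
      using c assms(9) by (simp add: delta_def)
  qed
  \<comment> \<open>Both \<open>v\<close> and \<open>p\<close> start at \<open>v\<close>, so
    \<open>V v\<close> is the left unit that \<open>min_lideal_eq_principal\<close> asks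
    for.\<close>
  moreover have "V v * (z * y) = z * y"
    using V_path[OF assms(5) v] V_V[OF v v] by (simp add: z_def left_diff_distrib right_diff_distrib flip: mult.assoc)
  ultimately have "M = (\<lambda>a. a * (z * y)) ` R"
    using M(5)[OF z assms(2)] by (intro min_lideal_eq_principal[OF assms(1)]) (auto intro: V_R v)
  then obtain a where a: "a \<in> R" "y = a * (z * y)"
    using assms(2) by blast
  then have "r = act (a * (z * y)) (delta q) q"
    using y by (simp add: delta_def)
  also have "\<dots> = r * (c * act a (delta q) q)"
    using a(1) z M(1)[OF assms(2)] by (simp add: act_mult[of a] R_mult w act_linear mult.assoc)
  finally have "1 = c * act a (delta q) q"
    using assms(9) by simp
  then have "fps_nth (c * act a (delta q) q) 0 = 1"
    by simp
  then show False
    by (simp add: c_def fps_power_zeroth)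
qed


subsection \<open>Reduction to a vertex\<close>

text \<open>While the constant coefficient is 0, the empty terms cancel and can be deleted without
  changing the element. Then some e^* keeps it nonzero and makes the list lighter, so the descent
  must end at a nonzero constant coefficient.\<close>

lemma ex_path_sum_const_coeff:
  assumes "lideal M" "path_sum v xs \<in> M" "path_sum v xs \<noteq> 0" "paths_to v xs"
  obtains ys where "path_sum v ys \<in> M" "paths_to v ys" "const_coeff ys \<noteq> 0" "weight ys \<le> weight xs"
proof -
  note M = lidealD[OF assms(1)]
  have "\<exists>ys. path_sum v ys \<in> M \<and> paths_to v ys \<and> const_coeff ys \<noteq> 0 \<and> weight ys \<le> weight xs"
    using assms(2-4)
  proof (induction "weight xs" arbitrary: xs rule: less_induct)
    case less
    show ?case
    proof (cases "const_coeff xs = 0")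
      case True
      define ys where "ys = filter (\<lambda>(k, p). p \<noteq> []) xs"
      have "path_sum v xs = scale (const_coeff xs) (V v) + path_sum v ys"
        unfolding ys_def by (induction xs) (auto simp: scale_add_left algebra_simps)
      then have eq: "path_sum v ys = path_sum v xs"
        using True by simp
      have ys: "paths_to v ys" "\<forall>(k, p) \<in> set ys. p \<noteq> []"
        using less.prems(3) by (auto simp: ys_def paths_to_def)
      have le: "weight ys \<le> weight xs"
        unfolding ys_def by (induction xs) auto
      have "ys \<noteq> []"
        using less.prems(2) eq by auto
      define F where "F = (\<lambda>(k, p). hd p) ` set ys"
      have F: "finite F" "F \<subseteq> arcs G"
        using ys by (auto simp: F_def paths_to_def neq_Nil_conv awalk_simps split: prod.splits) force
      have "(\<Sum>e\<in>F. X e * (Y e * path_sum v ys)) \<noteq> 0"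
        using path_sum_eq_sum_X_Y[OF ys F] less.prems(2) eq by (force simp: F_def)
      then obtain e where e: "e \<in> F" "Y e * path_sum v ys \<noteq> 0"
        by (metis (no_types, lifting) mult_zero_right sum.neutral)
      then have "e \<in> arcs G"
        using F by blast
      note * = Y_path_sum[OF this ys]
      have "Y e * path_sum v ys \<in> M"
        using less.prems(1) eq \<open>e \<in> arcs G\<close> by (auto intro: M(5) Y_R)
      then show ?thesis
        using less.hyps[OF _ _ _ *(2)] *(1) *(3)[OF \<open>ys \<noteq> []\<close>] e(2) le
        by (metis (no_types, lifting) order.strict_trans2 order.trans order.strict_implies_order)
    qed (use less.prems in blast)
  qed
  then show ?thesis
    using that by blast
qed

text \<open>The previous descent is applied to the left ideal of all \<open>x\<close> with
  \<open>x * X f = 0\<close>. It produces a y in there with nonzero constant coefficient; but f^* y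
  f has the same constant coefficient and so cannot be 0.\<close>

lemma path_sum_mult_X_nonzero:
  assumes "paths_to v xs" "path_sum v xs \<noteq> 0" "f \<in> out_arcs G v"
  shows "path_sum v xs * X f \<noteq> 0"
proof
  assume *: "path_sum v xs * X f = 0"
  have "lideal {x \<in> R. x * X f = 0}"
    using R_zero R_add R_uminus R_mult by (auto simp: lideal_def distrib_right mult.assoc)
  then obtain ys where ys: "path_sum v ys * X f = 0" "paths_to v ys" "const_coeff ys \<noteq> 0"
    using ex_path_sum_const_coeff[of "{x \<in> R. x * X f = 0}" v xs] * path_sum_R assms(1,2) by blast
  have f: "awalk v [f] (head G f)" "path (head G f) [f] = X f"
    using assms(3) by (auto simp: awalk_simps X_V)
  have "path_sum (head G f) (conjugate v [f] ys) \<noteq> 0"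
    using conjugate(2,3)[OF f(1) ys(2)] ys(3) by (intro path_sum_nonzero) auto
  then show False
    using conjugate(1)[OF f(1) ys(2)] ys(1) unfolding f(2) by (simp add: mult.assoc)
qed

text \<open>The isomorphism is required to be right multiplication by some \<open>n\<close>. Such
  maps are left linear by associativity and compose, so the property can be pulled back along each
  step from \<open>M\<close> to \<open>M n\<close>.\<close>

definition line_point_principal :: "'r set \<Rightarrow> bool"
  where "line_point_principal M \<longleftrightarrow> (\<exists>v n. line_point G v \<and> n \<in> R \<and>
    (\<forall>x\<in>M. x * n = 0 \<longrightarrow> x = 0) \<and> (\<lambda>x. x * n) ` M = (\<lambda>a. a * V v) ` R)"

lemma line_point_principal_mult_right:
  assumes "min_lideal M" "n \<in> R" "x \<in> M" "x * n \<noteq> 0" "line_point_principal ((\<lambda>x. x * n) ` M)"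
  shows "line_point_principal M"
proof -
  obtain v m where m: "line_point G v" "m \<in> R" "\<And>x. \<lbrakk>x \<in> M; x * n * m = 0\<rbrakk> \<Longrightarrow> x * n = 0"
    "(\<lambda>x. x * m) ` (\<lambda>x. x * n) ` M = (\<lambda>a. a * V v) ` R"
    using assms(5) unfolding line_point_principal_def by auto
  then show ?thesis
    unfolding line_point_principal_def
    using min_lideal_mult_right(2)[OF assms(1-4)] R_mult[OF assms(2) m(2)]
    by (intro exI[of _ v] exI[of _ "n * m"]) (auto simp: image_image mult.assoc)
qed

text \<open>For a path \<open>p\<close> from \<open>v\<close> to \<open>w\<close>, the left ideal
  \<open>M p\<close> is again minimal and contains v p = p, hence also p^* p = w. So each vertex of
  \<open>T(v)\<close> lies in a minimal left ideal, and bifurcations and cycles only have to be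
  excluded there.\<close>

lemma line_point_if_V_in_min_lideal:
  assumes "min_lideal M" "V v \<in> M" "v \<in> verts G"
  shows "line_point G v"
  unfolding line_point_def
proof (intro conjI ballI)
  fix w assume "w \<in> descendants G v"
  then obtain p where p: "awalk v p w"
    by (auto simp: descendants_def)
  have w: "w \<in> verts G"
    using p by (rule awalk_last_in_verts)
  let ?M' = "(\<lambda>x. x * path w p) ` M"
  have "path w p \<noteq> 0"
    using ghost_path_same[OF p] V_nonzero[OF w] by auto
  moreover have "V v * path w p = path w p"
    using V_path[OF p] assms(3) by simp
  ultimately have M': "min_lideal ?M'" and "path w p \<in> ?M'"
    using min_lideal_mult_right(1)[OF assms(1) path_R[OF p] assms(2)] assms(2) by (auto intro: image_eqI[of _ _ "V v"])
  note D = lidealD[OF min_lideal_lideal[OF M']]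
  have Vw: "V w \<in> ?M'"
    using D(5)[OF ghost_R[OF p] \<open>path w p \<in> ?M'\<close>] ghost_path_same[OF p] by simp
  show "\<not> bifurcation G w"
  proof
    assume "bifurcation G w"
    then obtain e f where ef: "e \<in> arcs G" "f \<in> arcs G" "tail G e = w" "tail G f = w" "e \<noteq> f"
      by (auto simp: bifurcation_def)
    have "X e * Y e = X e * Y e * V w"
      using Y_V[OF ef(1)] ef(3) by (simp add: mult.assoc)
    moreover have XY: "X e * Y e \<in> R"
      using ef by (intro R_mult X_R Y_R)
    ultimately have "X e * Y e \<in> ?M'"
      using D(5)[OF _ Vw] by metis
    moreover have "X e * Y e * (X e * Y e) = X e * Y e"
      using V_Y[OF ef(1)] Y_X[OF ef(1,1)] by (metis mult.assoc)
    moreover have "Y e * (X e * Y e) * X e = V (head G e)"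
      using V_Y[OF ef(1)] Y_X[OF ef(1,1)] by (metis mult.assoc)
    then have "X e * Y e \<noteq> 0"
      using V_nonzero[of "head G e"] ef(1) by auto
    \<comment> \<open>Minimality makes \<open>V w\<close> a left multiple of e e^*. Since e^* f = 0,
      multiplying by \<open>f\<close> on the right gives f = 0, whereas f^* f is a nonzero
      vertex.\<close>
    ultimately obtain a where "V w = a * (X e * Y e)"
      using min_lideal_eq_principal[OF M' _ _ XY] Vw by blast
    then have "V w * X f = 0"
      using Y_X[OF ef(1,2)] ef(5) by (simp add: mult.assoc)
    then have "X f = 0"
      using V_X[OF ef(2)] ef(4) by simp
    then show False
      using Y_X[OF ef(2,2)] V_nonzero[of "head G f"] ef(2) by simp
  qed
  show "\<not> cycle_base G w"
  proof
    assume "cycle_base G w"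
    then obtain c u where "awalk u c u" "c \<noteq> []" "tail G (hd c) = w"
      by (auto simp: cycle_base_def cycle_def)
    then have c: "awalk w c w" "c \<noteq> []"
      by (cases c; auto simp: awalk_simps)+
    obtain q where q: "q \<in> inf_paths" "source q = w" "prepend c q = q"
      using ex_periodic_path[OF c] by blast
    \<comment> \<open>The vertex fixes the indicator of the periodic path around the cycle: the
      eigenvalue is 1.\<close>
    have "act (V w) (delta q) s = 1 * delta q s" for s
      using q w by (auto simp: act_V act_vertex_def delta_def)
    from not_min_lideal_if_eigenvector[OF M' Vw q(1,2) c q(3) this] show False
      by simp
  qed
qed (rule assms(3))

lemma line_point_principal_if_V:
  assumes "min_lideal M" "V v \<in> M" "v \<in> verts G"
  shows "line_point_principal M"
proof -
  have M: "M = (\<lambda>a. a * V v) ` R"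
    using assms V_V by (intro min_lideal_eq_principal[where z = "V v"]) (auto simp: V_nonzero V_R)
  have id: "x * V v = x" if "x \<in> M" for x
    using that V_V[OF assms(3,3)] unfolding M by (auto simp: mult.assoc)
  have "(\<lambda>x. x * V v) ` M = (\<lambda>x. x) ` M"
    by (rule image_cong) (auto simp: id)
  then have "(\<lambda>x. x * V v) ` M = (\<lambda>a. a * V v) ` R"
    using M by (simp only: image_ident)
  moreover have "\<forall>x\<in>M. x * V v = 0 \<longrightarrow> x = 0"
    by (auto simp: id)
  ultimately show ?thesis
    unfolding line_point_principal_def
    using line_point_if_V_in_min_lideal[OF assms] V_R[OF assms(3)] by blast
qed

lemma line_point_principal_if_path_sum:
  assumes "min_lideal M" "path_sum v xs \<in> M" "path_sum v xs \<noteq> 0" "paths_to v xs"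
  shows "line_point_principal M"
  using assms
proof (induction "weight xs" arbitrary: M v xs rule: less_induct)
  case less
  note M = lidealD[OF min_lideal_lideal[OF less.prems(1)]]
  obtain ys where ys: "path_sum v ys \<in> M" "paths_to v ys" "const_coeff ys \<noteq> 0" "weight ys \<le> weight xs"
    using ex_path_sum_const_coeff[OF min_lideal_lideal[OF less.prems(1)] less.prems(2-4)] by blast
  have v: "v \<in> verts G"
    using ys(2) by (simp add: paths_to_def)
  \<comment> \<open>Conjugation by \<open>p\<close> keeps the constant coefficient, so the product
    stays nonzero, and losing the term \<open>q\<close> makes the induction hypothesis applicable to
    \<open>M p\<close>.\<close>
  have smaller: ?case
    if "awalk v p w" "(k, q) \<in> set ys" "\<not> (awalk v q v \<and> take (length p) (q @ p) = p)" for p w k q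
  proof -
    note C = conjugate[OF that(1) ys(2)]
    have nz: "path_sum w (conjugate v p ys) \<noteq> 0"
      using C(2,3) ys(3) by (intro path_sum_nonzero) auto
    then have nz': "ghost w p * path_sum v ys * path w p \<noteq> 0"
      using C(1) by simp
    have mem: "ghost w p * path_sum v ys \<in> M"
      using M(5) ghost_R[OF that(1)] ys(1) by blast
    have "line_point_principal ((\<lambda>x. x * path w p) ` M)"
    proof (rule less.hyps[OF _ _ _ nz C(2)])
      show "weight (conjugate v p ys) < weight xs"
        using C(5)[OF that(2,3)] ys(4) by simp
      show "min_lideal ((\<lambda>x. x * path w p) ` M)"
        by (rule min_lideal_mult_right(1)[OF less.prems(1) path_R[OF that(1)] mem nz'])
      show "path_sum w (conjugate v p ys) \<in> (\<lambda>x. x * path w p) ` M"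
        unfolding C(1)[symmetric] using mem by blast
    qed
    then show ?thesis
      by (rule line_point_principal_mult_right[OF less.prems(1) path_R[OF that(1)] mem nz'])
  qed
  show ?case
  proof (cases "\<forall>(k, p) \<in> set ys. p = []")
    case True
    then have "path_sum v ys = scale (const_coeff ys) (V v)"
      by (induction ys) (auto simp: scale_add_left)
    then have "scale (1 / const_coeff ys) (V v) * path_sum v ys = V v"
      using ys(3) V_V[OF v v] by (simp add: mult_scale_left mult_scale_right scale_scale scale_one)
    then have "V v \<in> M"
      using M(5)[OF scale_R[OF V_R[OF v]] ys(1)] by metis
    then show ?thesis
      using line_point_principal_if_V less.prems(1) v by blast
  next
    case False
    then obtain k p where p: "(k, p) \<in> set ys" "p \<noteq> []"
      by auto
    show ?thesis
    proof (rule ccontr)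
      assume no: "\<not> line_point_principal M"
      \<comment> \<open>For the empty path, conjugation is y -> v y v, which loses every term that
        does not start at \<open>v\<close>.\<close>
      have closed: "awalk v q v" if "(k, q) \<in> set ys" for k q
        using smaller[of "[]" v k q] that v no by (auto simp: awalk_simps)
      have compat: "take (length p') (q @ p') = p'" if "(k, q) \<in> set ys" "awalk v p' w" for k q p' w
        using smaller[OF that(2,1)] no by blast
      have pv: "awalk v p v"
        using closed p(1) by blast
      obtain q where q: "q \<in> inf_paths" "source q = v" "prepend p q = q"
        using ex_periodic_path[OF pv p(2)] by blast
      define rep where "rep n = concat (replicate n p)" for n
      have rep: "awalk v (rep n) v" "prepend (rep n) q = q" for n
        using pv v q(3) by (induction n) (simp_all add: rep_def awalk_Nil_iff prepend_append)
      have len: "length (rep n) = n * length p" for n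
        by (induction n) (simp_all add: rep_def)
      \<comment> \<open>Compared at position \<open>i\<close>: since \<open>p\<close> is nonempty,
        p^(i+1) is a prefix of \<open>q\<close> that covers \<open>i\<close>; by
        \<open>compat\<close> it is also a prefix of p' p^(i+1), hence of p' q.\<close>
      have "prepend p' q = q" if "(k, p') \<in> set ys" for k p'
      proof
        fix i
        have i: "i < length (rep (Suc i))"
          using p(2) by (cases p) (simp_all add: len)
        have "prepend p' q i = prepend (p' @ rep (Suc i)) q i"
          by (simp add: prepend_append rep(2))
        also have "\<dots> = Inr (take (length (rep (Suc i))) (p' @ rep (Suc i)) ! i)"
          using i by (simp add: prepend_nth del: take_append)
        also have "\<dots> = Inr (rep (Suc i) ! i)"
          using compat[OF that rep(1)] by (simp del: take_append)
        also have "\<dots> = prepend (rep (Suc i)) q i"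
          using i by (simp add: prepend_nth)
        finally show "prepend p' q i = q i"
          by (simp add: rep(2))
      qed
      then have "\<forall>(k, p') \<in> set ys. prepend p' q = q"
        by blast
      \<comment> \<open>As every term fixes \<open>q\<close>, the eigenvalue is a polynomial in 1 +
        t, with constant coefficient \<open>const_coeff ys\<close>.\<close>
      then have act: "act (path_sum v ys) (delta q) s =
          (\<Sum>(k, n)\<leftarrow>map (\<lambda>(k, p). (k, length p)) ys. fps_const k * (1 + fps_X) ^ n) * delta q s" for s
        unfolding act_path_sum[OF ys(2) q(1,2)] by (induction ys) (auto simp: delta_def distrib_right)
      have "(\<Sum>(k, n)\<leftarrow>map (\<lambda>(k, p). (k, length p)) ys. if n = 0 then k else 0) = const_coeff ys"
        by (induction ys) auto
      then show False
        using not_min_lideal_if_eigenvector[OF less.prems(1) ys(1) q(1,2) pv p(2) q(3) act]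
          fps_sum_list_powers_nonzero ys(3) by metis
    qed
  qed
qed

subsection \<open>Ghost edges\<close>

text \<open>Says that \<open>x\<close> is a combination of terms p q^* with q of length at most
  \<open>d\<close> and starting at \<open>v\<close>, unfolded along the last ghost edge. With
  \<open>b\<close> zero outside \<open>F\<close>, right multiplication by any edge \<open>f\<close>
  leaving \<open>v\<close> turns the ghost part into \<open>b f\<close>, also for \<open>f\<close>
  outside \<open>F\<close>.\<close>

primrec ghost_degree_le :: "nat \<Rightarrow> 'a \<Rightarrow> 'r \<Rightarrow> bool" where
  "ghost_degree_le 0 v x \<longleftrightarrow> (\<exists>xs. paths_to v xs \<and> x = path_sum v xs)"
| "ghost_degree_le (Suc d) v x \<longleftrightarrow> (\<exists>xs b F. paths_to v xs \<and> finite F \<and> F \<subseteq> out_arcs G v \<and>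
    (\<forall>e \<in> out_arcs G v. ghost_degree_le d (head G e) (b e)) \<and> (\<forall>e. e \<notin> F \<longrightarrow> b e = 0) \<and>
    x = path_sum v xs + (\<Sum>e\<in>F. b e * Y e))"

lemma ghost_degree_le_SucI:
  assumes "paths_to v xs" "finite F" "F \<subseteq> out_arcs G v"
    "\<And>e. e \<in> out_arcs G v \<Longrightarrow> ghost_degree_le d (head G e) (b e)" "\<And>e. e \<notin> F \<Longrightarrow> b e = 0"
    "x = path_sum v xs + (\<Sum>e\<in>F. b e * Y e)"
  shows "ghost_degree_le (Suc d) v x"
  unfolding ghost_degree_le.simps using assms by (intro exI[of _ xs] exI[of _ b] exI[of _ F]) auto

lemma ghost_degree_le_path_sum: "paths_to v xs \<Longrightarrow> ghost_degree_le d v (path_sum v xs)"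
proof (induction d arbitrary: v xs)
  case (Suc d)
  have "ghost_degree_le d (head G e) 0" if "e \<in> out_arcs G v" for e
    using Suc.IH[of "head G e" "[]"] that by auto
  then show ?case
    using Suc.prems by (auto intro!: exI[of _ xs] exI[of _ "\<lambda>_. 0"] exI[of _ "{}"])
qed auto

lemma ghost_degree_le_zero: "v \<in> verts G \<Longrightarrow> ghost_degree_le d v 0"
  using ghost_degree_le_path_sum[of v "[]"] by simp

lemma ghost_degree_le_add:
  "\<lbrakk>ghost_degree_le d v x; ghost_degree_le d v y\<rbrakk> \<Longrightarrow> ghost_degree_le d v (x + y)"
proof (induction d arbitrary: v x y)
  case 0
  then show ?case
    by (metis ghost_degree_le.simps(1) path_sum_append paths_to_append)
next
  case (Suc d)
  obtain xs b F where x: "paths_to v xs" "finite F" "F \<subseteq> out_arcs G v"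
    "\<forall>e \<in> out_arcs G v. ghost_degree_le d (head G e) (b e)" "\<forall>e. e \<notin> F \<longrightarrow> b e = 0"
    "x = path_sum v xs + (\<Sum>e\<in>F. b e * Y e)"
    using Suc.prems(1) by auto
  obtain ys c F' where y: "paths_to v ys" "finite F'" "F' \<subseteq> out_arcs G v"
    "\<forall>e \<in> out_arcs G v. ghost_degree_le d (head G e) (c e)" "\<forall>e. e \<notin> F' \<longrightarrow> c e = 0"
    "y = path_sum v ys + (\<Sum>e\<in>F'. c e * Y e)"
    using Suc.prems(2) by auto
  have "(\<Sum>e\<in>F. b e * Y e) = (\<Sum>e\<in>F \<union> F'. b e * Y e)" "(\<Sum>e\<in>F'. c e * Y e) = (\<Sum>e\<in>F \<union> F'. c e * Y e)"
    using x(2,5) y(2,5) by (auto intro!: sum.mono_neutral_left)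
  then have "x + y = path_sum v (xs @ ys) + (\<Sum>e\<in>F \<union> F'. (b e + c e) * Y e)"
    using x(6) y(6) by (simp add: distrib_right sum.distrib)
  moreover have "\<forall>e \<in> out_arcs G v. ghost_degree_le d (head G e) (b e + c e)"
    using x(4) y(4) Suc.IH by blast
  ultimately show ?case
    unfolding ghost_degree_le.simps using x y
    by (intro exI[of _ "xs @ ys"] exI[of _ "\<lambda>e. b e + c e"] exI[of _ "F \<union> F'"]) auto
qed

lemma ghost_degree_le_scale: "ghost_degree_le d v x \<Longrightarrow> ghost_degree_le d v (scale k x)"
proof (induction d arbitrary: v x)
  case 0
  then obtain xs where "paths_to v xs" "x = path_sum v xs"
    by auto
  moreover have "scale k (path_sum v xs) = path_sum v (map (\<lambda>(l, p). (k * l, p)) xs)" for xs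
    by (induction xs) (auto simp: scale_add scale_scale)
  moreover have "paths_to v (map (\<lambda>(l, p). (k * l, p)) xs)" if "paths_to v xs" for xs
    using that by (induction xs) auto
  ultimately show ?case
    by (metis ghost_degree_le.simps(1))
next
  case (Suc d)
  obtain xs b F where x: "paths_to v xs" "finite F" "F \<subseteq> out_arcs G v"
    "\<forall>e \<in> out_arcs G v. ghost_degree_le d (head G e) (b e)" "\<forall>e. e \<notin> F \<longrightarrow> b e = 0"
    "x = path_sum v xs + (\<Sum>e\<in>F. b e * Y e)"
    using Suc.prems(1) by auto
  have *: "scale k (path_sum v xs) = path_sum v (map (\<lambda>(l, p). (k * l, p)) xs)"
    by (induction xs) (auto simp: scale_add scale_scale)
  have "paths_to v (map (\<lambda>(l, p). (k * l, p)) xs)"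
    using x(1) by (induction xs) auto
  moreover have "scale k (\<Sum>e\<in>F. b e * Y e) = (\<Sum>e\<in>F. scale k (b e) * Y e)"
    by (induction F rule: infinite_finite_induct) (auto simp: scale_add mult_scale_left)
  ultimately show ?case
    unfolding ghost_degree_le.simps using x Suc.IH
    by (intro exI[of _ "map (\<lambda>(l, p). (k * l, p)) xs"] exI[of _ "\<lambda>e. scale k (b e)"] exI[of _ F])
      (auto simp: scale_add *)
qed

lemma ghost_degree_le_Suc: "ghost_degree_le d v x \<Longrightarrow> ghost_degree_le (Suc d) v x"
proof (induction d arbitrary: v x)
  case 0
  then show ?case
    using ghost_degree_le_path_sum by (metis ghost_degree_le.simps(1))
next
  case (Suc d)
  obtain xs b F where x: "paths_to v xs" "finite F" "F \<subseteq> out_arcs G v"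
    "\<forall>e \<in> out_arcs G v. ghost_degree_le d (head G e) (b e)" "\<forall>e. e \<notin> F \<longrightarrow> b e = 0"
    "x = path_sum v xs + (\<Sum>e\<in>F. b e * Y e)"
    using Suc.prems unfolding ghost_degree_le.simps by blast
  have "\<forall>e \<in> out_arcs G v. ghost_degree_le (Suc d) (head G e) (b e)"
    using x(4) Suc.IH by (simp del: ghost_degree_le.simps)
  then show ?case
    using x by (intro ghost_degree_le_SucI[of v xs F "Suc d" b]) blast+
qed

lemma ghost_degree_le_mono:
  assumes "d \<le> d'" "ghost_degree_le d v x"
  shows "ghost_degree_le d' v x"
  using assms by (induction d' rule: dec_induct) (auto simp del: ghost_degree_le.simps intro: ghost_degree_le_Suc)

lemma ghost_degree_le_V: "ghost_degree_le d v x \<Longrightarrow> x * V v = x"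
proof (cases d)
  case 0
  then show "ghost_degree_le d v x \<Longrightarrow> x * V v = x"
    by (auto simp: path_sum_V)
next
  case (Suc d')
  assume "ghost_degree_le d v x"
  then obtain xs b F where x: "paths_to v xs" "F \<subseteq> out_arcs G v" "x = path_sum v xs + (\<Sum>e\<in>F. b e * Y e)"
    unfolding Suc ghost_degree_le.simps by blast
  have "b e * Y e * V v = b e * Y e" if "e \<in> F" for e
    using subsetD[OF x(2) that] Y_V[of e] by (auto simp: mult.assoc)
  then have "(\<Sum>e\<in>F. b e * Y e) * V v = (\<Sum>e\<in>F. b e * Y e)"
    unfolding sum_distrib_right by (intro sum.cong) auto
  then show "x * V v = x"
    using x by (simp add: distrib_right path_sum_V)
qed

lemma sum_Y_mult_X:
  assumes "finite F" "F \<subseteq> arcs G" "f \<in> arcs G" "b f * V (head G f) = b f" "f \<notin> F \<Longrightarrow> b f = 0"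
  shows "(\<Sum>e\<in>F. b e * Y e) * X f = b f"
proof -
  have "(\<Sum>e\<in>F. b e * Y e) * X f = (\<Sum>e\<in>F. if e = f then b f else 0)"
    unfolding sum_distrib_right using assms by (intro sum.cong) (auto simp: mult.assoc Y_X)
  then show ?thesis
    using assms(1,5) by auto
qed

text \<open>By CK1 the ghost part times \<open>f\<close> is \<open>b f\<close>, whose degree is at
  most \<open>d\<close>, and the real part stays real.\<close>

lemma ghost_degree_le_mult_X:
  assumes "ghost_degree_le (Suc d) v x" "f \<in> out_arcs G v"
  shows "ghost_degree_le d (head G f) (x * X f)"
proof -
  obtain xs b F where x: "paths_to v xs" "finite F" "F \<subseteq> out_arcs G v"
    "\<forall>e \<in> out_arcs G v. ghost_degree_le d (head G e) (b e)" "\<forall>e. e \<notin> F \<longrightarrow> b e = 0"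
    "x = path_sum v xs + (\<Sum>e\<in>F. b e * Y e)"
    using assms(1) unfolding ghost_degree_le.simps by blast
  have "(\<Sum>e\<in>F. b e * Y e) * X f = b f"
    using x(2,3,5) assms(2) ghost_degree_le_V[OF bspec[OF x(4) assms(2)]] by (intro sum_Y_mult_X) auto
  then show ?thesis
    using path_sum_X[OF x(1) assms(2)] x(4) assms(2)
    by (auto simp: x(6) distrib_right intro!: ghost_degree_le_add ghost_degree_le_path_sum)
qed

text \<open>Letters are appended on the right: a vertex keeps the element or gives 0, an edge lowers
  the bound, and a ghost edge raises it by one.\<close>

lemma ex_ghost_degree_le:
  assumes "x \<in> R" "v \<in> verts G"
  shows "\<exists>d. ghost_degree_le d v (x * V v)"
  using assms unfolding R_eq
proof (induction arbitrary: v rule: subalgebra.induct)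
  have mult_generator: "\<exists>d. ghost_degree_le d v (x * g * V v)"
    if IH: "\<And>v. v \<in> verts G \<Longrightarrow> \<exists>d. ghost_degree_le d v (x * V v)"
      and g: "g \<in> V ` verts G \<union> X ` arcs G \<union> Y ` arcs G" and v: "v \<in> verts G" for x g v
  proof -
    have zero: "\<exists>d. ghost_degree_le d v 0"
      using ghost_degree_le_zero[OF v] by blast
    from g consider u where "u \<in> verts G" "g = V u" | e where "e \<in> arcs G" "g = X e" | e where "e \<in> arcs G" "g = Y e"
      by blast
    then show ?thesis
    proof cases
      case 1
      then show ?thesis
        using IH[OF v] v zero by (auto simp: V_V mult.assoc)
    next
      case 2
      show ?thesis
      proof (cases "v = head G e")
        case True
        \<comment> \<open>\<open>ghost_degree_le_mult_X\<close> consumes a successor, so the bound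
          is raised by one beforehand.\<close>
        obtain d where "ghost_degree_le (Suc d) (tail G e) (x * V (tail G e))"
          using IH[of "tail G e"] 2 ghost_degree_le_Suc by (metis tail_in_verts)
        then have "ghost_degree_le d v (x * V (tail G e) * X e)"
          unfolding True using 2 by (intro ghost_degree_le_mult_X) auto
        then show ?thesis
          using 2 True by (auto simp: mult.assoc V_X X_V)
      next
        case False
        then have "X e * V v = 0"
          using X_V[OF 2(1)] V_V[of "head G e" v] 2(1) v by (metis head_in_verts mult.assoc mult_zero_right)
        then show ?thesis
          using zero 2 by (simp add: mult.assoc)
      qed
    next
      case 3
      show ?thesis
      proof (cases "v = tail G e")
        case True
        obtain d where d: "ghost_degree_le d (head G e) (x * V (head G e))"
          using IH[of "head G e"] 3 by auto
        let ?b = "\<lambda>f. if f = e then x * V (head G e) else 0"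
        have "ghost_degree_le (Suc d) v (x * Y e)"
          using 3 v True d
          by (intro ghost_degree_le_SucI[of v "[]" "{e}" d ?b])
            (auto simp: ghost_degree_le_zero mult.assoc V_Y)
        then show ?thesis
          using 3 True by (auto simp: mult.assoc Y_V simp del: ghost_degree_le.simps)
      next
        case False
        then have "Y e * V v = 0"
          using Y_V[OF 3(1)] V_V[of "tail G e" v] 3(1) v by (metis tail_in_verts mult.assoc mult_zero_right)
        then show ?thesis
          using zero 3 by (simp add: mult.assoc)
      qed
    qed
  qed
  {
    case (mult x g)
    show ?case
      by (rule mult_generator[OF mult.IH mult.hyps(2) mult.prems])
  next
    case (generator g)
    consider u where "u \<in> verts G" "g = V u" | e where "e \<in> arcs G" "g = X e" | e where "e \<in> arcs G" "g = Y e"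
      using generator(1) by blast
    \<comment> \<open>A single generator is a vertex times itself, which reduces it to the case of a
      product.\<close>
    then obtain u where u: "u \<in> verts G" "V u * g = g"
    proof cases
      case (1 u)
      then show ?thesis
        using V_V that by simp
    next
      case (2 e)
      then show ?thesis
        using V_X[of e] that tail_in_verts[of e] by metis
    next
      case (3 e)
      then show ?thesis
        using V_Y[of e] that head_in_verts[of e] by metis
    qed
    have "\<exists>d. ghost_degree_le d w (V u * V w)" if "w \<in> verts G" for w
      using u(1) that ghost_degree_le_path_sum[of w "[(1, [])]"] ghost_degree_le_zero[OF that]
      by (auto simp: V_V scale_one awalk_simps)
    then show ?case
      using mult_generator[of "V u" g v] generator u(2) by simp
  next
    case zero
    then show ?case
      using ghost_degree_le_zero by auto
  next
    case (add x y)
    obtain d d' where "ghost_degree_le d v (x * V v)" "ghost_degree_le d' v (y * V v)"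
      using add.IH[OF add.prems] by blast
    then have "ghost_degree_le (max d d') v (x * V v + y * V v)"
      by (intro ghost_degree_le_add) (auto simp del: ghost_degree_le.simps intro: ghost_degree_le_mono[rotated])
    then show ?case
      by (auto simp: distrib_right)
  next
    case (scale x k)
    obtain d where "ghost_degree_le d v (x * V v)"
      using scale.IH[OF scale.prems] by blast
    then have "ghost_degree_le d v (scale k x * V v)"
      by (simp only: mult_scale_left ghost_degree_le_scale)
    then show ?case ..
  }
qed

text \<open>If some \<open>x f\<close> is nonzero, the degree drops on passing to
  \<open>M f\<close>. If all vanish, \<open>x\<close> turns out to be a combination of real paths
  already.\<close>

lemma line_point_principal_if_ghost_degree_le:
  assumes "min_lideal M" "x \<in> M" "x \<noteq> 0" "v \<in> verts G" "ghost_degree_le d v x"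
  shows "line_point_principal M"
  using assms
proof (induction d arbitrary: M v x)
  case 0
  then show ?case
    using line_point_principal_if_path_sum by auto
next
  case (Suc d)
  show ?case
  proof (cases "\<exists>f \<in> out_arcs G v. x * X f \<noteq> 0")
    case True
    then obtain f where f: "f \<in> out_arcs G v" "x * X f \<noteq> 0"
      by blast
    then have Xf: "X f \<in> R" "head G f \<in> verts G"
      by (auto intro: X_R)
    have "line_point_principal ((\<lambda>x. x * X f) ` M)"
      using Suc.IH[OF min_lideal_mult_right(1)[OF Suc.prems(1) Xf(1) Suc.prems(2) f(2)] _ f(2) Xf(2)]
        ghost_degree_le_mult_X[OF Suc.prems(5) f(1)] Suc.prems(2) by blast
    then show ?thesis
      by (rule line_point_principal_mult_right[OF Suc.prems(1) Xf(1) Suc.prems(2) f(2)])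
  next
    case False
    obtain xs b F where x: "paths_to v xs" "finite F" "F \<subseteq> out_arcs G v"
      "\<forall>e \<in> out_arcs G v. ghost_degree_le d (head G e) (b e)" "\<forall>e. e \<notin> F \<longrightarrow> b e = 0"
      "x = path_sum v xs + (\<Sum>e\<in>F. b e * Y e)"
      using Suc.prems(5) unfolding ghost_degree_le.simps by blast
    \<comment> \<open>Let y be the real part. Then x is y minus y times the sum of e e^* over
      \<open>F\<close>. An edge \<open>f\<close> outside \<open>F\<close> would give y f = 0,
      impossible for nonzero y; so \<open>F\<close> consists of all edges leaving \<open>v\<close>.
      Were there any, CK2 would give x = 0. Hence \<open>v\<close> is a sink and x = y.\<close>
    have b: "b f = - (path_sum v xs * X f)" if "f \<in> out_arcs G v" for f
    proof -
      have "(\<Sum>e\<in>F. b e * Y e) * X f = b f"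
        using x(2,3,5) that ghost_degree_le_V[OF bspec[OF x(4) that]] by (intro sum_Y_mult_X) auto
      moreover have "x * X f = 0"
        using False that by blast
      ultimately have "path_sum v xs * X f + b f = 0"
        by (simp add: x(6) distrib_right)
      then show ?thesis
        by (simp add: eq_neg_iff_add_eq_0 add.commute)
    qed
    have "(\<Sum>e\<in>F. b e * Y e) = (\<Sum>e\<in>F. - (path_sum v xs * (X e * Y e)))"
      using b x(3) by (intro sum.cong) (auto simp: mult.assoc)
    then have eq: "x = path_sum v xs - path_sum v xs * (\<Sum>e\<in>F. X e * Y e)"
      by (simp add: x(6) sum_negf sum_distrib_left)
    have nz: "path_sum v xs \<noteq> 0"
      using eq Suc.prems(3) by auto
    have F: "F = out_arcs G v"
    proof (rule ccontr)
      assume "F \<noteq> out_arcs G v"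
      then obtain f where "f \<in> out_arcs G v" "f \<notin> F"
        using x(3) by blast
      then show False
        using b[of f] x(5) path_sum_mult_X_nonzero[OF x(1) nz] by simp
    qed
    have "\<not> regular_vertex G v"
      using eq path_sum_V[OF x(1)] CK2[of v] Suc.prems(3) F by auto
    then have "F = {}"
      using F x(2) Suc.prems(4) by (simp add: regular_vertex_def)
    then have "x = path_sum v xs"
      using eq by simp
    then show ?thesis
      using line_point_principal_if_path_sum[OF Suc.prems(1)] x(1) nz Suc.prems(2) by blast
  qed
qed

lemma min_lideal_line_point_principal:
  assumes "min_lideal M"
  shows "line_point_principal M"
proof -
  note M = lidealD[OF min_lideal_lideal[OF assms]]
  obtain x where x: "x \<in> M" "x \<noteq> 0"
    using assms M(2) unfolding min_lideal_def by blast
  then obtain v where v: "v \<in> verts G" "x * V v \<noteq> 0"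
    using ex_mult_V_nonzero M(1) by blast
  obtain d where "ghost_degree_le d v (x * V v)"
    using ex_ghost_degree_le M(1)[OF x(1)] v(1) by blast
  then have "line_point_principal ((\<lambda>x. x * V v) ` M)"
    using min_lideal_mult_right(1)[OF assms V_R[OF v(1)] x(1) v(2)] x(1) v
    by (intro line_point_principal_if_ghost_degree_le) auto
  then show ?thesis
    by (rule line_point_principal_mult_right[OF assms V_R[OF v(1)] x(1) v(2)])
qed

end

section \<open>Linear endomorphisms\<close>

lemma poly_mapping_single_induct [case_names single add]:
  assumes "\<And>w c. P (Poly_Mapping.single w c)" "\<And>p q. P p \<Longrightarrow> P q \<Longrightarrow> P (p + q)"
  shows "P (p :: 'w \<Rightarrow>\<^sub>0 'c::monoid_add)"
proof (induction p rule: update_induct)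
  case const
  show ?case
    using assms(1)[of undefined 0] by simp
next
  case (update p w c)
  have "Poly_Mapping.update w c p = p + Poly_Mapping.single w c"
    using update(1) by (intro poly_mapping_eqI) (auto simp: lookup_update lookup_add lookup_single in_keys_iff)
  then show ?case
    using assms update(3) by simp
qed

abbreviation scalar :: "'k \<Rightarrow> ('w::monoid_add \<Rightarrow>\<^sub>0 'k::field)"
  where "scalar \<equiv> Poly_Mapping.single 0"

lemma mult_scalar: "p * (scalar k * q) = scalar k * (p * q)"
proof -
  have "p * scalar k = scalar k * p"
    by (induction p rule: poly_mapping_single_induct) (simp_all add: mult_single distrib_left distrib_right mult.commute)
  then show ?thesis
    by (simp flip: mult.assoc)
qed

text \<open>The second condition is \<open>K\<close>-linearity, as \<open>scalar k\<close> is the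
  constant \<open>k\<close> placed at the neutral exponent. Under composition these maps form a type
  of class \<open>ring\<close> in which the quotient can live.\<close>

typedef (overloaded) ('w, 'k) lin_end =
  "{f :: ('w::monoid_add \<Rightarrow>\<^sub>0 'k::field) \<Rightarrow> ('w \<Rightarrow>\<^sub>0 'k).
    (\<forall>x y. f (x + y) = f x + f y) \<and> (\<forall>k x. f (scalar k * x) = scalar k * f x)}"
  by (intro exI[of _ "\<lambda>_. 0"]) simp

setup_lifting type_definition_lin_end

lift_definition scale_end :: "'k \<Rightarrow> ('w::monoid_add, 'k::field) lin_end \<Rightarrow> ('w, 'k) lin_end"
  is "\<lambda>k f x. scalar k * f x"
  using mult_scalar by (auto simp: distrib_left)

instantiation lin_end :: (monoid_add, field) ring
begin

lift_definition zero_lin_end :: "('a, 'b) lin_end" is "\<lambda>_. 0"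
  by simp

lift_definition plus_lin_end :: "('a, 'b) lin_end \<Rightarrow> ('a, 'b) lin_end \<Rightarrow> ('a, 'b) lin_end"
  is "\<lambda>f g x. f x + g x"
  by (auto simp: distrib_left)

lift_definition minus_lin_end :: "('a, 'b) lin_end \<Rightarrow> ('a, 'b) lin_end \<Rightarrow> ('a, 'b) lin_end"
  is "\<lambda>f g x. f x - g x"
  by (auto simp: right_diff_distrib)

lift_definition uminus_lin_end :: "('a, 'b) lin_end \<Rightarrow> ('a, 'b) lin_end"
  is "\<lambda>f x. - f x"
  by auto

lift_definition times_lin_end :: "('a, 'b) lin_end \<Rightarrow> ('a, 'b) lin_end \<Rightarrow> ('a, 'b) lin_end"
  is "\<lambda>f g x. f (g x)"
  by auto

instance
  by standard (transfer; auto simp: algebra_simps)+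

end

lemma vector_space_scalar: "vector_space (\<lambda>k p. scalar k * (p :: 'w::monoid_add \<Rightarrow>\<^sub>0 'k::field))"
  by standard (simp_all add: distrib_left distrib_right single_add mult_single flip: mult.assoc)

text \<open>Projection along \<open>J\<close>: a basis \<open>B\<close> of \<open>J\<close> is
  extended to a basis \<open>C\<close> of the whole space; \<open>\<pi>\<close> kills
  \<open>B\<close> and fixes the rest of \<open>C\<close>.\<close>

lemma ex_linear_with_kernel:
  fixes J :: "('w::monoid_add \<Rightarrow>\<^sub>0 'k::field) set"
  assumes "0 \<in> J" "\<And>p q. \<lbrakk>p \<in> J; q \<in> J\<rbrakk> \<Longrightarrow> p + q \<in> J" "\<And>k p. p \<in> J \<Longrightarrow> scalar k * p \<in> J"
  obtains \<pi> where "\<And>p q. \<pi> (p + q) = \<pi> p + \<pi> q" "\<And>k p. \<pi> (scalar k * p) = scalar k * \<pi> p"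
    "\<And>p. \<pi> p = 0 \<longleftrightarrow> p \<in> J" "\<And>p. p - \<pi> p \<in> J"
proof -
  interpret vs: vector_space "\<lambda>k p. scalar k * (p :: 'w \<Rightarrow>\<^sub>0 'k)"
    by (rule vector_space_scalar)
  interpret vsp: vector_space_pair "\<lambda>k p. scalar k * (p :: 'w \<Rightarrow>\<^sub>0 'k)" "\<lambda>k p. scalar k * (p :: 'w \<Rightarrow>\<^sub>0 'k)"
    by unfold_locales
  have J: "vs.subspace J"
    by (rule vs.subspaceI) (use assms in auto)
  obtain B where B: "B \<subseteq> J" "vs.independent B" "J \<subseteq> vs.span B"
    using vs.maximal_independent_subset by blast
  obtain C where C: "B \<subseteq> C" "vs.independent C" "UNIV \<subseteq> vs.span C"
    by (rule vs.maximal_independent_subset_extend[OF subset_UNIV B(2)]) (rule that; assumption)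
  obtain \<pi> where lin: "Vector_Spaces.linear (\<lambda>k p. scalar k * p) (\<lambda>k p. scalar k * p) \<pi>"
    and \<pi>: "\<forall>x\<in>C. \<pi> x = (if x \<in> B then 0 else x)"
    using vsp.linear_independent_extend[OF C(2), of "\<lambda>x. if x \<in> B then 0 else x"]
    by (elim exE conjE) (rule that; assumption)
  interpret \<pi>: Vector_Spaces.linear "\<lambda>k p. scalar k * (p :: 'w \<Rightarrow>\<^sub>0 'k)" "\<lambda>k p. scalar k * (p :: 'w \<Rightarrow>\<^sub>0 'k)" \<pi>
    by (rule lin)
  have sub: "vs.subspace {p. p - \<pi> p \<in> J}"
  proof (rule vs.subspaceI)
    fix x y assume "x \<in> {p. p - \<pi> p \<in> J}" "y \<in> {p. p - \<pi> p \<in> J}"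
    then have "(x - \<pi> x) + (y - \<pi> y) \<in> J"
      using assms(2) by blast
    then show "x + y \<in> {p. p - \<pi> p \<in> J}"
      by (simp add: \<pi>.add algebra_simps)
  next
    fix k x assume "x \<in> {p. p - \<pi> p \<in> J}"
    then have "scalar k * (x - \<pi> x) \<in> J"
      using assms(3) by blast
    then show "scalar k * x \<in> {p. p - \<pi> p \<in> J}"
      by (simp add: \<pi>.scale right_diff_distrib)
  qed (simp add: assms(1) \<pi>.zero)
  have "C \<subseteq> {p. p - \<pi> p \<in> J}"
    using \<pi> B(1) assms(1) by auto
  then have "vs.span C \<subseteq> {p. p - \<pi> p \<in> J}"
    using sub by (rule vs.span_minimal)
  then have diff: "p - \<pi> p \<in> J" for p
    using C(3) by blast
  have "\<pi> p = 0" if "p \<in> J" for p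
  proof (rule \<pi>.eq_0_on_span)
    show "\<pi> b = 0" if "b \<in> B" for b
      using bspec[OF \<pi> subsetD[OF C(1) that]] that by simp
    show "p \<in> vs.span B"
      using B(3) that by (rule subsetD)
  qed
  moreover have "p \<in> J" if "\<pi> p = 0" for p
    using diff[of p] that by simp
  ultimately show ?thesis
    by (intro that[of \<pi>] \<pi>.add \<pi>.scale diff) auto
qed

text \<open>
  A quotient of the free algebra is no type of its own; it embeds into the linear endomorphisms of
  the free algebra by letting \<open>p\<close> act as \<open>x \<mapsto> \<pi> (p x)\<close> for a linear projection \<open>\<pi>\<close> with kernel \<open>J\<close>.
\<close>

lemma ex_quotient_embedding:
  fixes J :: "('w::monoid_add \<Rightarrow>\<^sub>0 'k::field) set"
  assumes "0 \<in> J" "\<And>p q. \<lbrakk>p \<in> J; q \<in> J\<rbrakk> \<Longrightarrow> p + q \<in> J" "\<And>a p. p \<in> J \<Longrightarrow> a * p \<in> J"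
    "\<And>a p. p \<in> J \<Longrightarrow> p * a \<in> J"
  obtains \<kappa> :: "('w \<Rightarrow>\<^sub>0 'k) \<Rightarrow> ('w, 'k) lin_end" where
    "\<And>p q. \<kappa> (p + q) = \<kappa> p + \<kappa> q" "\<And>p q. \<kappa> (p * q) = \<kappa> p * \<kappa> q"
    "\<And>k p. \<kappa> (scalar k * p) = scale_end k (\<kappa> p)" "\<And>p. \<kappa> p = 0 \<longleftrightarrow> p \<in> J"
proof -
  obtain \<pi> where \<pi>: "\<And>p q. \<pi> (p + q) = \<pi> p + \<pi> q" "\<And>k p. \<pi> (scalar k * p) = scalar k * \<pi> p"
    "\<And>p. \<pi> p = 0 \<longleftrightarrow> p \<in> J" "\<And>p. p - \<pi> p \<in> J"
    by (rule ex_linear_with_kernel[OF assms(1-3)]) (assumption | rule that)+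
  define \<kappa> where "\<kappa> p = Abs_lin_end (\<lambda>x. \<pi> (p * x))" for p
  have Rep: "Rep_lin_end (\<kappa> p) = (\<lambda>x. \<pi> (p * x))" for p
    unfolding \<kappa>_def by (intro Abs_lin_end_inverse) (auto simp: \<pi> distrib_left mult_scalar)
  have eq: "\<pi> (p * \<pi> x) = \<pi> (p * x)" for p x
  proof -
    have "\<pi> (p * (x - \<pi> x)) = 0"
      using \<pi>(3,4) assms(3) by blast
    then have "\<pi> (p * (x - \<pi> x)) + \<pi> (p * \<pi> x) = \<pi> (p * \<pi> x)"
      by simp
    then show ?thesis
      by (simp flip: \<pi>(1) distrib_left)
  qed
  have "\<kappa> p = 0 \<longleftrightarrow> p \<in> J" for p
  proof -
    \<comment> \<open>Faithfulness comes from x = 1: the surrounding free algebra has a unit even if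
      the path algebra has none.\<close>
    have "\<kappa> p = 0 \<longleftrightarrow> (\<forall>x. p * x \<in> J)"
      unfolding Rep_lin_end_inject[symmetric] Rep zero_lin_end.rep_eq by (auto simp: fun_eq_iff \<pi>(3))
    then show ?thesis
      using assms(4)[of p] by (metis mult.right_neutral)
  qed
  moreover have "\<kappa> (p + q) = \<kappa> p + \<kappa> q" for p q
    by (simp add: Rep plus_lin_end.rep_eq \<pi>(1) distrib_right flip: Rep_lin_end_inject)
  moreover have "\<kappa> (p * q) = \<kappa> p * \<kappa> q" for p q
    by (simp add: Rep times_lin_end.rep_eq eq mult.assoc flip: Rep_lin_end_inject)
  moreover have "\<kappa> (scalar k * p) = scale_end k (\<kappa> p)" for k p
    by (simp add: Rep scale_end.rep_eq \<pi>(2) mult.assoc flip: Rep_lin_end_inject)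
  ultimately show ?thesis
    by (intro that[of \<kappa>]) auto
qed


section \<open>The action of the free algebra\<close>

context wf_digraph
begin

primrec act_letter ::
  "('a, 'b) lpa_gen \<Rightarrow> ((nat \<Rightarrow> 'a + 'b) \<Rightarrow> 'k::field fps) \<Rightarrow> (nat \<Rightarrow> 'a + 'b) \<Rightarrow> 'k fps" where
  "act_letter (Vertex v) = act_vertex v"
| "act_letter (Edge e) = act_edge e"
| "act_letter (Ghost e) = act_ghost e"

definition act_poly :: "('a, 'b, 'k::field) free_lpa \<Rightarrow>
    ((nat \<Rightarrow> 'a + 'b) \<Rightarrow> 'k fps) \<Rightarrow> (nat \<Rightarrow> 'a + 'b) \<Rightarrow> 'k fps"
  where "act_poly p \<phi> q =
    (\<Sum>w \<in> Poly_Mapping.keys p. fps_const (Poly_Mapping.lookup p w) * foldr act_letter w \<phi> q)"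

lemma act_letter_add: "act_letter g (\<lambda>q. \<phi> q + \<psi> q) = (\<lambda>q. act_letter g \<phi> q + act_letter g \<psi> q)"
  by (cases g) (auto simp: fun_eq_iff act_vertex_def act_edge_def act_ghost_def distrib_left)

lemma act_letter_cmult: "act_letter g (\<lambda>q. c * \<phi> q) = (\<lambda>q. c * act_letter g \<phi> q)"
  by (cases g) (auto simp: fun_eq_iff act_vertex_def act_edge_def act_ghost_def mult.left_commute)

lemma act_word_add:
  "foldr act_letter w (\<lambda>q. \<phi> q + \<psi> q) = (\<lambda>q. foldr act_letter w \<phi> q + foldr act_letter w \<psi> q)"
  by (induction w) (simp_all add: act_letter_add)

lemma act_word_cmult: "foldr act_letter w (\<lambda>q. c * \<phi> q) = (\<lambda>q. c * foldr act_letter w \<phi> q)"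
  by (induction w) (simp_all add: act_letter_cmult)

lemma act_poly_superset:
  assumes "finite F" "Poly_Mapping.keys p \<subseteq> F"
  shows "act_poly p \<phi> q = (\<Sum>w\<in>F. fps_const (Poly_Mapping.lookup p w) * foldr act_letter w \<phi> q)"
  unfolding act_poly_def using assms by (intro sum.mono_neutral_left) (auto simp: in_keys_iff)

lemma act_poly_add: "act_poly (p + p') \<phi> q = act_poly p \<phi> q + act_poly p' \<phi> q"
proof -
  let ?F = "Poly_Mapping.keys p \<union> Poly_Mapping.keys p'"
  have "Poly_Mapping.keys (p + p') \<subseteq> ?F"
    by (rule Poly_Mapping.keys_add)
  then show ?thesis
    by (simp add: act_poly_superset[of ?F] lookup_add distrib_right sum.distrib flip: fps_const_add)
qed

lemma act_poly_single: "act_poly (Poly_Mapping.single w c) \<phi> q = fps_const c * foldr act_letter w \<phi> q"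
  by (cases "c = 0") (simp_all add: act_poly_def)

lemma act_poly_zero [simp]: "act_poly 0 \<phi> q = 0"
  by (simp add: act_poly_def)

lemma act_poly_generator: "act_poly (generator g) \<phi> = act_letter g \<phi>"
  by (simp add: fun_eq_iff generator_def act_poly_single)

lemma act_poly_diff: "act_poly (p - p') \<phi> q = act_poly p \<phi> q - act_poly p' \<phi> q"
  using act_poly_add[of "p - p'" p' \<phi> q] by (simp add: algebra_simps)

lemma act_poly_sum: "act_poly (sum f A) \<phi> q = (\<Sum>i\<in>A. act_poly (f i) \<phi> q)"
  by (induction A rule: infinite_finite_induct) (simp_all add: act_poly_add)

lemma act_poly_cmult: "act_poly p (\<lambda>q. c * \<phi> q) q = c * act_poly p \<phi> q"
  by (simp add: act_poly_def act_word_cmult sum_distrib_left mult.left_commute)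

lemma act_poly_fun_add: "act_poly p (\<lambda>q. \<phi> q + \<psi> q) q = act_poly p \<phi> q + act_poly p \<psi> q"
  by (simp add: act_poly_def act_word_add distrib_left sum.distrib)

lemma act_poly_mult: "act_poly (p * p') \<phi> = act_poly p (act_poly p' \<phi>)"
proof
  fix q
  show "act_poly (p * p') \<phi> q = act_poly p (act_poly p' \<phi>) q"
  proof (induction p' rule: poly_mapping_single_induct)
    case (single w c)
    show ?case
    proof (induction p rule: poly_mapping_single_induct)
      case (single v d)
      have "act_poly (Poly_Mapping.single w c) \<phi> = (\<lambda>q. fps_const c * foldr act_letter w \<phi> q)"
        by (simp add: fun_eq_iff act_poly_single)
      then show ?case
        by (simp add: mult_single act_poly_single act_word_cmult plus_list_def mult.assoc flip: fps_const_mult)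
    qed (simp add: distrib_right act_poly_add)
  next
    case (add p' p'')
    have "act_poly (p' + p'') \<phi> = (\<lambda>q. act_poly p' \<phi> q + act_poly p'' \<phi> q)"
      by (simp add: fun_eq_iff act_poly_add)
    then show ?case
      using add by (simp add: distrib_left act_poly_add act_poly_fun_add)
  qed
qed

lemma act_poly_relations:
  fixes r :: "('a, 'b, 'k::field) free_lpa"
  assumes "r \<in> lpa_relations G"
  shows "act_poly r \<phi> q = 0"
proof -
  have unit: "(1 + fps_X) * inverse (1 + fps_X) = (1 :: 'k fps)" "inverse (1 + fps_X) * (1 + fps_X) = (1 :: 'k fps)"
    by (auto intro: inverse_mult_eq_1 inverse_mult_eq_1')
  have unit': "(1 + fps_X) * (inverse (1 + fps_X) * c) = c" "inverse (1 + fps_X) * ((1 + fps_X) * c) = c" for c :: "'k fps"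
    using unit by (simp_all flip: mult.assoc)
  note simps = act_poly_diff act_poly_mult act_poly_generator
  consider
      u w where "u \<in> verts G" "w \<in> verts G"
        "r = generator (Vertex u) * generator (Vertex w) - (if u = w then generator (Vertex u) else 0)"
    | e where "e \<in> arcs G" "r = generator (Vertex (tail G e)) * generator (Edge e) - generator (Edge e)"
    | e where "e \<in> arcs G" "r = generator (Edge e) * generator (Vertex (head G e)) - generator (Edge e)"
    | e where "e \<in> arcs G" "r = generator (Vertex (head G e)) * generator (Ghost e) - generator (Ghost e)"
    | e where "e \<in> arcs G" "r = generator (Ghost e) * generator (Vertex (tail G e)) - generator (Ghost e)"
    | e f where "e \<in> arcs G" "f \<in> arcs G"
        "r = generator (Ghost e) * generator (Edge f) - (if e = f then generator (Vertex (head G e)) else 0)"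
    | u where "regular_vertex G u"
        "r = generator (Vertex u) - (\<Sum>e \<in> out_arcs G u. generator (Edge e) * generator (Ghost e))"
    using assms unfolding lpa_relations_def Let_def by blast
  then show ?thesis
  proof cases
    case 1
    then show ?thesis
      by (auto simp: simps act_vertex_def)
  next
    case 2
    then show ?thesis
      using source_tl[of q e] by (auto simp: simps act_vertex_def act_edge_def)
  next
    case 3
    then show ?thesis
      using source_tl[of q e] by (auto simp: simps act_vertex_def act_edge_def inf_paths_tl)
  next
    case 4
    then show ?thesis
      by (auto simp: simps act_vertex_def act_ghost_def)
  next
    case 5
    then show ?thesis
      by (auto simp: simps act_vertex_def act_ghost_def inf_paths_case_nat)
  next
    case 6
    then show ?thesis
      by (auto simp: simps act_vertex_def act_ghost_def act_edge_def inf_paths_case_nat unit')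
  next
    case 7
    have eq: "act_poly r \<phi> q = act_vertex u \<phi> q - (\<Sum>e \<in> out_arcs G u. act_edge e (act_ghost e \<phi>) q)"
      by (simp add: 7(2) simps act_poly_sum)
    show ?thesis
    proof (cases "q \<in> inf_paths \<and> source q = u")
      case True
      \<comment> \<open>An infinite path from a regular vertex begins with an edge \<open>e\<close>,
        and only the summand e e^* contributes to the value at \<open>q\<close>.\<close>
      then obtain e where e: "q 0 = Inr e" "e \<in> out_arcs G u"
        using inf_paths_regular 7(1) by metis
      have "case_nat (Inr e) (\<lambda>n. q (Suc n)) = q"
        using case_nat_tl[of q] e(1) by simp
      then have "act_edge f (act_ghost f \<phi>) q = (if f = e then \<phi> q else 0)" for f
        using True e source_tl[of q e] by (auto simp: act_edge_def act_ghost_def unit' inf_paths_tl)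
      then show ?thesis
        using True e(2) 7(1) by (simp add: eq act_vertex_def regular_vertex_def)
    next
      case False
      have "act_edge e (act_ghost e \<phi>) q = 0" if "e \<in> out_arcs G u" for e
        using False that source_tl[of q e] by (auto simp: act_edge_def)
      moreover have "act_vertex u \<phi> q = 0"
        using False by (auto simp: act_vertex_def)
      ultimately show ?thesis
        by (simp add: eq)
    qed
  qed
qed

end

section \<open>Extending the ideal of relations to all generators\<close>

lift_definition restrict_keys :: "'w set \<Rightarrow> ('w \<Rightarrow>\<^sub>0 'c::zero) \<Rightarrow> ('w \<Rightarrow>\<^sub>0 'c)"
  is "\<lambda>S f w. if w \<in> S then f w else 0"
  by (auto elim: rev_finite_subset)

lemma restrict_keys_add: "restrict_keys S (p + q) = restrict_keys S p + restrict_keys S (q :: 'w \<Rightarrow>\<^sub>0 'c::monoid_add)"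
  by (intro poly_mapping_eqI) (simp add: restrict_keys.rep_eq lookup_add)

lemma keys_restrict_keys: "Poly_Mapping.keys (restrict_keys S p) = Poly_Mapping.keys p \<inter> S"
  by (auto simp: in_keys_iff restrict_keys.rep_eq split: if_splits)

lemma restrict_keys_id: "Poly_Mapping.keys p \<subseteq> S \<Longrightarrow> restrict_keys S p = p"
  by (intro poly_mapping_eqI) (auto simp: restrict_keys.rep_eq in_keys_iff)

lemma restrict_keys_eq_0: "Poly_Mapping.keys p \<inter> S = {} \<Longrightarrow> restrict_keys S p = 0"
  by (intro poly_mapping_eqI) (auto simp: restrict_keys.rep_eq in_keys_iff)

lemma keys_diff_restrict_keys:
  "Poly_Mapping.keys (p - restrict_keys S p) = Poly_Mapping.keys (p :: 'w \<Rightarrow>\<^sub>0 'c::ab_group_add) - S"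
  by (auto simp: in_keys_iff lookup_minus restrict_keys.rep_eq split: if_splits)

text \<open>A concatenation uses only letters of \<open>S\<close> exactly when both factors do, so
  discarding all other words is multiplicative.\<close>

lemma restrict_keys_lists_mult:
  fixes p q :: "'a list \<Rightarrow>\<^sub>0 'k::field"
  shows "restrict_keys (lists S) (p * q) = restrict_keys (lists S) p * restrict_keys (lists S) q"
proof -
  let ?r = "restrict_keys (lists S) :: ('a list \<Rightarrow>\<^sub>0 'k) \<Rightarrow> _"
  have off: "Poly_Mapping.keys (x - ?r x) \<inter> lists S = {}" for x
    unfolding keys_diff_restrict_keys by blast
  have "?r (x * y) = 0"
    if "Poly_Mapping.keys x \<inter> lists S = {} \<or> Poly_Mapping.keys y \<inter> lists S = {}" for x y :: "'a list \<Rightarrow>\<^sub>0 'k"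
    using that keys_mult[of x y] by (intro restrict_keys_eq_0) (fastforce simp: plus_list_def)
  then have "?r ((p - ?r p) * q) = 0" "?r (?r p * (q - ?r q)) = 0"
    using off by blast+
  moreover have "p * q = (p - ?r p) * q + (?r p * (q - ?r q) + ?r p * ?r q)"
    by (simp add: algebra_simps)
  moreover have "?r (?r p * ?r q) = ?r p * ?r q"
    by (intro restrict_keys_id keys_mult_lists) (simp_all add: keys_restrict_keys)
  ultimately show ?thesis
    by (simp add: restrict_keys_add)
qed

context wf_digraph
begin

text \<open>\<open>lpa_ideal G\<close> is an ideal among polynomials in the generators of the graph,
  while the type also contains words with foreign letters. Its preimage under discarding those words
  is a two-sided ideal of the whole type and agrees with it on polynomials in the
  generators.\<close>

definition full_ideal :: "('a, 'b, 'k::field) free_lpa set"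
  where "full_ideal = {p. restrict_keys (lists (lpa_gens G)) p \<in> lpa_ideal G}"

lemma lpa_ideal_closed:
  fixes p q :: "('a, 'b, 'k::field) free_lpa"
  shows "0 \<in> (lpa_ideal G :: ('a, 'b, 'k) free_lpa set)"
    and "\<lbrakk>p \<in> lpa_ideal G; q \<in> lpa_ideal G\<rbrakk> \<Longrightarrow> p + q \<in> lpa_ideal G"
    and "p \<in> lpa_ideal G \<Longrightarrow> - p \<in> lpa_ideal G"
    and "\<lbrakk>p \<in> lpa_ideal G; Poly_Mapping.keys q \<subseteq> lists (lpa_gens G)\<rbrakk> \<Longrightarrow> q * p \<in> lpa_ideal G"
    and "\<lbrakk>p \<in> lpa_ideal G; Poly_Mapping.keys q \<subseteq> lists (lpa_gens G)\<rbrakk> \<Longrightarrow> p * q \<in> lpa_ideal G"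
proof -
  interpret J: ideal "lpa_ideal G :: ('a, 'b, 'k) free_lpa set" "free_algebra (lpa_gens G)"
    by (rule ideal_lpa_ideal)
  show "0 \<in> (lpa_ideal G :: ('a, 'b, 'k) free_lpa set)"
    using additive_subgroup.zero_closed[OF J.additive_subgroup_axioms] by simp
  show "\<lbrakk>p \<in> lpa_ideal G; q \<in> lpa_ideal G\<rbrakk> \<Longrightarrow> p + q \<in> lpa_ideal G"
    using additive_subgroup.a_closed[OF J.additive_subgroup_axioms, of p q] by simp
  show l: "\<lbrakk>p \<in> lpa_ideal G; Poly_Mapping.keys q \<subseteq> lists (lpa_gens G)\<rbrakk> \<Longrightarrow> q * p \<in> lpa_ideal G" for q
    using J.I_l_closed[of p q] by simp
  show "\<lbrakk>p \<in> lpa_ideal G; Poly_Mapping.keys q \<subseteq> lists (lpa_gens G)\<rbrakk> \<Longrightarrow> p * q \<in> lpa_ideal G"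
    using J.I_r_closed[of p q] by simp
  show "- p \<in> lpa_ideal G" if "p \<in> lpa_ideal G"
    using l[of "- 1"] that by (simp add: zero_list_def)
qed

lemma full_ideal_closed:
  fixes p q :: "('a, 'b, 'k::field) free_lpa"
  shows "0 \<in> (full_ideal :: ('a, 'b, 'k) free_lpa set)"
    and "\<lbrakk>p \<in> full_ideal; q \<in> full_ideal\<rbrakk> \<Longrightarrow> p + q \<in> full_ideal"
    and "p \<in> full_ideal \<Longrightarrow> q * p \<in> full_ideal"
    and "p \<in> full_ideal \<Longrightarrow> p * q \<in> full_ideal"
proof -
  have sub: "Poly_Mapping.keys (restrict_keys (lists (lpa_gens G)) q) \<subseteq> lists (lpa_gens G)"
    unfolding keys_restrict_keys by (rule Int_lower2)
  show "0 \<in> (full_ideal :: ('a, 'b, 'k) free_lpa set)"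
    using lpa_ideal_closed(1) by (simp add: full_ideal_def restrict_keys_id)
  show "\<lbrakk>p \<in> full_ideal; q \<in> full_ideal\<rbrakk> \<Longrightarrow> p + q \<in> full_ideal"
    by (simp add: full_ideal_def restrict_keys_add lpa_ideal_closed(2))
  show "p \<in> full_ideal \<Longrightarrow> q * p \<in> full_ideal" "p \<in> full_ideal \<Longrightarrow> p * q \<in> full_ideal"
    unfolding full_ideal_def mem_Collect_eq restrict_keys_lists_mult
    by (rule lpa_ideal_closed(4,5)[OF _ sub], assumption)+
qed

lemma full_ideal_iff:
  "Poly_Mapping.keys p \<subseteq> lists (lpa_gens G) \<Longrightarrow> p \<in> full_ideal \<longleftrightarrow> p \<in> lpa_ideal G"
  by (simp add: full_ideal_def restrict_keys_id)

text \<open>The polynomials that act as 0 form an ideal containing the relations.\<close>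

lemma act_poly_lpa_ideal:
  fixes p :: "('a, 'b, 'k::field) free_lpa"
  assumes "p \<in> lpa_ideal G"
  shows "act_poly p \<phi> q = 0"
proof -
  let ?F = "free_algebra (lpa_gens G) :: (('a, 'b) lpa_gen list \<Rightarrow>\<^sub>0 'k) ring"
  let ?Z = "{p \<in> carrier ?F. \<forall>\<phi> q. act_poly p \<phi> q = 0}"
  interpret R: ring ?F
    by (rule ring_free_algebra)
  have zero: "act_poly p (\<lambda>q. 0) q = 0" for p :: "('a, 'b, 'k) free_lpa" and q
    using act_poly_cmult[of p 0 "\<lambda>_. 0" q] by simp
  have inv: "inv\<^bsub>add_monoid ?F\<^esub> p = - p" if "p \<in> carrier ?F" for p
    using that R.minus_equality[of "- p" p] by (simp add: a_inv_def)
  have "ideal ?Z ?F"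
  proof (rule idealI[OF R.ring_axioms])
    show "subgroup ?Z (add_monoid ?F)"
    proof
      fix x y assume "x \<in> ?Z" "y \<in> ?Z"
      moreover from this have "Poly_Mapping.keys (x + y) \<subseteq> lists (lpa_gens G)"
        by (intro order.trans[OF Poly_Mapping.keys_add Un_least]) simp_all
      ultimately show "x \<otimes>\<^bsub>add_monoid ?F\<^esub> y \<in> ?Z"
        by (simp add: act_poly_add)
    next
      fix x assume "x \<in> ?Z"
      then show "inv\<^bsub>add_monoid ?F\<^esub> x \<in> ?Z"
        using act_poly_diff[of 0 x] by (subst inv) auto
    qed auto
  next
    fix a x assume a: "a \<in> ?Z" "x \<in> carrier ?F"
    then have "act_poly a \<phi> = (\<lambda>_. 0)" for \<phi>
      by auto
    then show "x \<otimes>\<^bsub>?F\<^esub> a \<in> ?Z" "a \<otimes>\<^bsub>?F\<^esub> x \<in> ?Z"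
      using a by (simp_all add: act_poly_mult zero keys_mult_lists)
  qed
  moreover have "lpa_relations G \<subseteq> ?Z"
    using lpa_relations_subset act_poly_relations by fastforce
  ultimately have "lpa_ideal G \<subseteq> ?Z"
    unfolding lpa_ideal_def by (rule R.genideal_minimal)
  then show ?thesis
    using assms by blast
qed

text \<open>A discarded word contains a foreign letter, which acts as 0; what remains lies in the
  ideal of relations.\<close>

lemma act_poly_full_ideal:
  fixes p :: "('a, 'b, 'k::field) free_lpa"
  assumes "p \<in> full_ideal"
  shows "act_poly p \<phi> q = 0"
proof -
  let ?L = "lists (lpa_gens G)"
  have bad: "act_letter g \<psi> = (\<lambda>_. 0)" if "g \<notin> lpa_gens G" for g and \<psi> :: "(nat \<Rightarrow> 'a + 'b) \<Rightarrow> 'k fps"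
  proof (rule ext, cases g)
    fix q
    show "act_letter g \<psi> q = 0" if g: "g = Vertex v" for v
    proof -
      have "source q \<in> verts G" if "q \<in> inf_paths"
      proof -
        have "q 0 \<in> Inl ` {v \<in> verts G. \<not> regular_vertex G v} \<union> Inr ` arcs G"
          using that by (auto simp: inf_paths_def)
        then show ?thesis
          by (auto simp: source_def letter_tail_def)
      qed
      then show ?thesis
        using \<open>g \<notin> lpa_gens G\<close> by (auto simp: g lpa_gens_def act_vertex_def)
    qed
    show "act_letter g \<psi> q = 0" if g: "g = Edge e" for e
      using \<open>g \<notin> lpa_gens G\<close> source_tl(2)[of q e] by (auto simp: g lpa_gens_def act_edge_def)
    show "act_letter g \<psi> q = 0" if g: "g = Ghost e" for e
      using \<open>g \<notin> lpa_gens G\<close> by (auto simp: g lpa_gens_def act_ghost_def)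
  qed
  have zero: "act_letter g (\<lambda>_. 0 :: 'k fps) = (\<lambda>_. 0)" for g
    using act_letter_cmult[of g 0 "\<lambda>_. 0"] by simp
  have word: "foldr act_letter w \<psi> = (\<lambda>_. 0)" if "w \<notin> ?L" for w and \<psi> :: "(nat \<Rightarrow> 'a + 'b) \<Rightarrow> 'k fps"
    using that
  proof (induction w)
    case (Cons g w)
    then show ?case
      by (cases "g \<in> lpa_gens G") (simp_all add: bad zero)
  qed simp
  have off: "w \<notin> ?L" if "w \<in> Poly_Mapping.keys (p - restrict_keys ?L p)" for w
    using that unfolding keys_diff_restrict_keys by blast
  have "act_poly (p - restrict_keys ?L p) \<phi> q = 0"
    unfolding act_poly_def using word[OF off] by (intro sum.neutral) simp
  moreover have "act_poly (restrict_keys ?L p) \<phi> q = 0"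
    using assms by (intro act_poly_lpa_ideal) (simp add: full_ideal_def)
  ultimately show ?thesis
    by (simp add: act_poly_diff)
qed

lemma ex_lpa_embedding:
  obtains \<kappa> :: "('a, 'b, 'k::field) free_lpa \<Rightarrow> (('a, 'b) lpa_gen list, 'k) lin_end" where
    "\<And>p q. \<kappa> (p + q) = \<kappa> p + \<kappa> q" "\<And>p q. \<kappa> (p * q) = \<kappa> p * \<kappa> q"
    "\<And>k p. \<kappa> (scalar k * p) = scale_end k (\<kappa> p)" "\<And>p. \<kappa> p = 0 \<longleftrightarrow> p \<in> full_ideal"
  by (rule ex_quotient_embedding[OF full_ideal_closed]) (assumption | rule that)+

end

section \<open>The Leavitt path algebra as a subring of linear endomorphisms\<close>

locale lpa_embedding = wf_digraph G for G :: "('a, 'b) pre_digraph" +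
  fixes \<kappa> :: "('a, 'b, 'k::field) free_lpa \<Rightarrow> (('a, 'b) lpa_gen list, 'k) lin_end"
  assumes \<kappa>_add: "\<kappa> (p + q) = \<kappa> p + \<kappa> q"
    and \<kappa>_mult: "\<kappa> (p * q) = \<kappa> p * \<kappa> q"
    and \<kappa>_scalar: "\<kappa> (scalar k * p) = scale_end k (\<kappa> p)"
    and \<kappa>_eq_0_iff: "\<kappa> p = 0 \<longleftrightarrow> p \<in> full_ideal"
begin

abbreviation "V v \<equiv> \<kappa> (generator (Vertex v))"
abbreviation "X e \<equiv> \<kappa> (generator (Edge e))"
abbreviation "Y e \<equiv> \<kappa> (generator (Ghost e))"
abbreviation "R \<equiv> subalgebra scale_end (V ` verts G \<union> X ` arcs G \<union> Y ` arcs G)"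
abbreviation "N \<equiv> carrier (free_nonunital_algebra (lpa_gens G)) :: ('a, 'b, 'k) free_lpa set"

text \<open>The choice of preimage is immaterial: two of them differ by an element of
  \<open>full_ideal\<close>, which acts as 0.\<close>

definition act where "act x = act_poly (SOME p. \<kappa> p = x)"

lemma \<kappa>_zero: "\<kappa> 0 = 0"
  using \<kappa>_add[of 0 0] by simp

lemma \<kappa>_diff: "\<kappa> (p - q) = \<kappa> p - \<kappa> q"
  using \<kappa>_add[of "p - q" q] by (simp add: eq_diff_eq)

lemma \<kappa>_sum: "\<kappa> (sum f A) = (\<Sum>i\<in>A. \<kappa> (f i))"
  by (induction A rule: infinite_finite_induct) (simp_all add: \<kappa>_add \<kappa>_zero)

lemma \<kappa>_relation: "r \<in> lpa_relations G \<Longrightarrow> \<kappa> r = 0"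
  using lpa_relations_subset_ideal lpa_relations_subset full_ideal_iff[of r]
  by (auto simp: \<kappa>_eq_0_iff)

lemma act_\<kappa>: "act (\<kappa> p) = act_poly p"
proof (intro ext)
  fix \<phi> q
  let ?p = "SOME p'. \<kappa> p' = \<kappa> p"
  have "\<kappa> ?p = \<kappa> p"
    by (rule someI) (rule refl)
  then have "?p - p \<in> full_ideal"
    by (simp add: \<kappa>_diff flip: \<kappa>_eq_0_iff)
  then have "act_poly (?p - p) \<phi> q = 0"
    by (rule act_poly_full_ideal)
  then show "act (\<kappa> p) \<phi> q = act_poly p \<phi> q"
    by (simp add: act_def act_poly_diff)
qed

lemma N_closed:
  shows "0 \<in> N" "\<lbrakk>p \<in> N; q \<in> N\<rbrakk> \<Longrightarrow> p + q \<in> N" "p \<in> N \<Longrightarrow> - p \<in> N" "\<lbrakk>p \<in> N; q \<in> N\<rbrakk> \<Longrightarrow> p * q \<in> N"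
    "p \<in> N \<Longrightarrow> scalar k * p \<in> N" "g \<in> lpa_gens G \<Longrightarrow> generator g \<in> N"
proof -
  show "0 \<in> N"
    by simp
  show "\<lbrakk>p \<in> N; q \<in> N\<rbrakk> \<Longrightarrow> p + q \<in> N"
    using Poly_Mapping.keys_add[of p q] by (auto simp: lookup_add simp del: in_lists_conv_set)
  show "p \<in> N \<Longrightarrow> - p \<in> N"
    by simp
  show "\<lbrakk>p \<in> N; q \<in> N\<rbrakk> \<Longrightarrow> p * q \<in> N"
    using keys_mult_lists[of p "lpa_gens G" q] by (auto simp: lookup_mult_Nil simp del: in_lists_conv_set)
  have "Poly_Mapping.keys (scalar k :: ('a, 'b, 'k) free_lpa) \<subseteq> lists (lpa_gens G)"
    by (simp add: zero_list_def)
  then show "p \<in> N \<Longrightarrow> scalar k * p \<in> N"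
    using keys_mult_lists[of "scalar k" "lpa_gens G" p] by (auto simp: lookup_mult_Nil simp del: in_lists_conv_set)
  show "g \<in> lpa_gens G \<Longrightarrow> generator g \<in> N"
    by (simp add: generator_def lookup_single)
qed

lemma generators_eq: "V ` verts G \<union> X ` arcs G \<union> Y ` arcs G = (\<lambda>g. \<kappa> (generator g)) ` lpa_gens G"
  by (auto simp: lpa_gens_def image_iff)

lemma R_subset: "R \<subseteq> \<kappa> ` N"
proof
  fix x assume "x \<in> R"
  then show "x \<in> \<kappa> ` N"
    unfolding generators_eq
  proof (induction rule: subalgebra.induct)
    case (generator g)
    then show ?case
      using N_closed(6) by blast
  next
    case zero
    show ?case
      using N_closed(1) \<kappa>_zero by (metis imageI)
  next
    case (add x y)
    then show ?case
      using N_closed(2) by (auto simp del: free_nonunital_algebra_simps simp flip: \<kappa>_add)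
  next
    case (scale x k)
    then show ?case
      using N_closed(5) by (auto simp del: free_nonunital_algebra_simps simp flip: \<kappa>_scalar)
  next
    case (mult x g)
    then show ?case
      using N_closed(4,6) by (auto simp del: free_nonunital_algebra_simps simp flip: \<kappa>_mult)
  qed
qed

text \<open>\<open>R\<close> is generated without a unit, so the empty word is excluded; this
  matches the vanishing constant coefficient in \<open>N\<close>.\<close>

lemma word_R:
  assumes "w \<in> lists (lpa_gens G)" "w \<noteq> []"
  shows "\<kappa> (Poly_Mapping.single w 1) \<in> R"
  using assms
proof (induction w rule: rev_induct)
  case (snoc g w)
  then have g: "\<kappa> (generator g) \<in> V ` verts G \<union> X ` arcs G \<union> Y ` arcs G"
    unfolding generators_eq by auto
  show ?case
  proof (cases "w = []")
    case True
    then show ?thesis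
      using subalgebra.generator[OF g] by (simp add: generator_def)
  next
    case False
    then have "\<kappa> (Poly_Mapping.single w 1) * \<kappa> (generator g) \<in> R"
      using snoc by (intro subalgebra.mult g) auto
    then show ?thesis
      by (simp add: generator_def mult_single plus_list_def flip: \<kappa>_mult)
  qed
qed simp

lemma \<kappa>_N: "p \<in> N \<Longrightarrow> \<kappa> p \<in> R"
proof -
  assume p: "p \<in> N"
  have word: "\<kappa> (Poly_Mapping.single w c) \<in> R" if "w \<in> lists (lpa_gens G)" "w \<noteq> []" for w c
    using subalgebra.scale[OF word_R[OF that], of c] by (simp add: mult_single flip: \<kappa>_scalar)
  have sum: "\<kappa> (\<Sum>w\<in>F. Poly_Mapping.single w (f w)) \<in> R"
    if "F \<subseteq> lists (lpa_gens G) - {[]}" for F and f :: "_ \<Rightarrow> 'k"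
  proof (use that in \<open>induction F rule: infinite_finite_induct\<close>)
    case (insert w F)
    have "\<kappa> (Poly_Mapping.single w (f w)) \<in> R"
      using insert.prems word by auto
    then show ?case
      using insert by (auto simp: \<kappa>_add intro: subalgebra.add)
  qed (simp_all add: \<kappa>_zero subalgebra.zero)
  have eq: "(\<Sum>w\<in>Poly_Mapping.keys p. Poly_Mapping.single w (Poly_Mapping.lookup p w)) = p"
    by (intro poly_mapping_eqI) (simp add: lookup_sum lookup_single when_def in_keys_iff)
  have "Poly_Mapping.keys p \<subseteq> lists (lpa_gens G) - {[]}"
    using p by (auto simp: in_keys_iff)
  from sum[OF this, of "Poly_Mapping.lookup p"] show "\<kappa> p \<in> R"
    unfolding eq .
qed

lemma \<kappa>_image_N: "\<kappa> ` N = R"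
  using R_subset \<kappa>_N by blast

sublocale leavitt_family G scale_end V X Y R act
proof unfold_locales
  let ?V = "\<lambda>v. generator (Vertex v) :: ('a, 'b, 'k) free_lpa"
  let ?X = "\<lambda>e. generator (Edge e) :: ('a, 'b, 'k) free_lpa"
  let ?Y = "\<lambda>e. generator (Ghost e) :: ('a, 'b, 'k) free_lpa"
  show "scale_end k (x + y) = scale_end k x + scale_end k y" for k and x y :: "(('a, 'b) lpa_gen list, 'k) lin_end"
    by transfer (simp add: distrib_left)
  show "scale_end (k + l) x = scale_end k x + scale_end l x" for k l and x :: "(('a, 'b) lpa_gen list, 'k) lin_end"
    by transfer (simp add: single_add distrib_right)
  show "scale_end k (scale_end l x) = scale_end (k * l) x" for k l and x :: "(('a, 'b) lpa_gen list, 'k) lin_end"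
    by transfer (simp add: mult_single flip: mult.assoc)
  show "scale_end 1 x = x" for x :: "(('a, 'b) lpa_gen list, 'k) lin_end"
    by transfer simp
  show "scale_end k x * y = scale_end k (x * y)" for k and x y :: "(('a, 'b) lpa_gen list, 'k) lin_end"
    by transfer simp
  show "x * scale_end k y = scale_end k (x * y)" for k and x y :: "(('a, 'b) lpa_gen list, 'k) lin_end"
    by transfer simp
  show "V u * V w = (if u = w then V u else 0)" if "u \<in> verts G" "w \<in> verts G" for u w
  proof -
    have "?V u * ?V w - (if u = w then ?V u else 0) \<in> lpa_relations G"
      unfolding lpa_relations_def Let_def using that by blast
    from \<kappa>_relation[OF this] show ?thesis
      by (auto simp: \<kappa>_diff \<kappa>_mult \<kappa>_zero split: if_splits)
  qed
  fix e assume e: "e \<in> arcs G"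
  have "?V (tail G e) * ?X e - ?X e \<in> lpa_relations G" "?X e * ?V (head G e) - ?X e \<in> lpa_relations G"
    "?V (head G e) * ?Y e - ?Y e \<in> lpa_relations G" "?Y e * ?V (tail G e) - ?Y e \<in> lpa_relations G"
    unfolding lpa_relations_def Let_def using e by blast+
  from this[THEN \<kappa>_relation] show "V (tail G e) * X e = X e" "X e * V (head G e) = X e"
    "V (head G e) * Y e = Y e" "Y e * V (tail G e) = Y e"
    by (simp_all add: \<kappa>_diff \<kappa>_mult)
  show "Y e * X f = (if e = f then V (head G e) else 0)" if "f \<in> arcs G" for f
  proof -
    have "?Y e * ?X f - (if e = f then ?V (head G e) else 0) \<in> lpa_relations G"
      unfolding lpa_relations_def Let_def using that e by blast
    from \<kappa>_relation[OF this] show ?thesis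
      by (auto simp: \<kappa>_diff \<kappa>_mult \<kappa>_zero split: if_splits)
  qed
  show "act (X e) = act_edge e"
    by (simp add: act_\<kappa> act_poly_generator fun_eq_iff)
next
  show "V u = (\<Sum>e\<in>out_arcs G u. X e * Y e)" if "regular_vertex G u" for u
  proof -
    have "generator (Vertex u) - (\<Sum>e\<in>out_arcs G u. generator (Edge e) * generator (Ghost e))
        \<in> (lpa_relations G :: ('a, 'b, 'k) free_lpa set)"
      unfolding lpa_relations_def Let_def using that by blast
    from \<kappa>_relation[OF this] show ?thesis
      by (simp add: \<kappa>_diff \<kappa>_sum \<kappa>_mult)
  qed
  show "act (V v) = act_vertex v" for v
    by (simp add: act_\<kappa> act_poly_generator fun_eq_iff)
  fix x assume "x \<in> R"
  then obtain p where x: "x = \<kappa> p"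
    using R_subset by blast
  show "act (scale_end k x) \<phi> q = fps_const k * act x \<phi> q" for k \<phi> q
    by (simp add: x act_\<kappa> act_poly_mult act_poly_single zero_list_def flip: \<kappa>_scalar)
  show "act x (\<lambda>p. c * \<phi> p) q = c * act x \<phi> q" for c \<phi> q
    by (simp add: x act_\<kappa> act_poly_cmult)
  fix y assume "y \<in> R"
  then obtain p' where y: "y = \<kappa> p'"
    using R_subset by blast
  show "act (x + y) \<phi> q = act x \<phi> q + act y \<phi> q" for \<phi> q
    by (simp add: x y act_\<kappa> act_poly_add flip: \<kappa>_add)
  show "act (x * y) \<phi> = act x (act y \<phi>)" for \<phi>
    by (simp add: x y act_\<kappa> act_poly_mult flip: \<kappa>_mult)
qed (rule refl)


section \<open>Transport between cosets and endomorphisms\<close>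

abbreviation L :: "('a, 'b, 'k) lpa ring"
  where "L \<equiv> leavitt_path_algebra G"

definition coset :: "('a, 'b, 'k) free_lpa \<Rightarrow> ('a, 'b, 'k) lpa"
  where "coset p = lpa_ideal G +>\<^bsub>free_nonunital_algebra (lpa_gens G)\<^esub> p"

text \<open>Independent of the representative, since \<open>\<kappa>\<close> kills the
  ideal.\<close>

definition embed :: "('a, 'b, 'k) lpa \<Rightarrow> (('a, 'b) lpa_gen list, 'k) lin_end"
  where "embed C = \<kappa> (SOME p. p \<in> C)"

lemma coset_eq: "coset p = (\<lambda>j. j + p) ` lpa_ideal G"
  by (auto simp: coset_def a_r_coset_def')

lemma carrier_L: "carrier L = coset ` N"
  by (auto simp: leavitt_path_algebra_def FactRing_def A_RCOSETS_def RCOSETS_def coset_def a_r_coset_def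
      simp del: free_nonunital_algebra_simps(1))

lemma \<kappa>_lpa_ideal: "j \<in> lpa_ideal G \<Longrightarrow> \<kappa> j = 0"
  using lpa_ideal_subset full_ideal_iff[of j] by (auto simp: \<kappa>_eq_0_iff)

lemma \<kappa>_eq_iff:
  assumes "p \<in> N" "q \<in> N"
  shows "\<kappa> p = \<kappa> q \<longleftrightarrow> p - q \<in> lpa_ideal G"
proof -
  have "p - q \<in> N"
    using N_closed(2)[OF assms(1) N_closed(3)[OF assms(2)]] by simp
  then have "p - q \<in> full_ideal \<longleftrightarrow> p - q \<in> lpa_ideal G"
    by (intro full_ideal_iff) simp
  then show ?thesis
    by (simp add: \<kappa>_diff flip: \<kappa>_eq_0_iff)
qed

lemma embed_coset: "embed (coset p) = \<kappa> p"
proof -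
  have "p \<in> coset p"
    using lpa_ideal_closed(1) by (force simp: coset_eq)
  then have "(SOME p'. p' \<in> coset p) \<in> coset p"
    by (rule someI)
  then show ?thesis
    by (auto simp: embed_def coset_eq \<kappa>_add \<kappa>_lpa_ideal)
qed

lemma coset_add:
  assumes "p \<in> N" "q \<in> N"
  shows "coset p \<oplus>\<^bsub>L\<^esub> coset q = coset (p + q)"
proof -
  have "coset p \<oplus>\<^bsub>L\<^esub> coset q = {x + y | x y. x \<in> coset p \<and> y \<in> coset q}"
    by (auto simp: leavitt_path_algebra_def FactRing_def set_add_def')
  also have "\<dots> = coset (p + q)"
  proof (intro subset_antisym subsetI)
    fix z assume "z \<in> {x + y | x y. x \<in> coset p \<and> y \<in> coset q}"
    then obtain i j where ij: "i \<in> lpa_ideal G" "j \<in> lpa_ideal G" "z = (i + p) + (j + q)"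
      by (auto simp: coset_eq)
    then show "z \<in> coset (p + q)"
      unfolding coset_eq by (intro image_eqI[of _ _ "i + j"]) (simp_all add: lpa_ideal_closed(2) algebra_simps)
  next
    fix z assume "z \<in> coset (p + q)"
    then obtain i where i: "i \<in> lpa_ideal G" "z = (i + p) + (0 + q)"
      by (auto simp: coset_eq algebra_simps)
    then show "z \<in> {x + y | x y. x \<in> coset p \<and> y \<in> coset q}"
      using lpa_ideal_closed(1) unfolding coset_eq by blast
  qed
  finally show ?thesis .
qed

lemma coset_mult: "\<lbrakk>p \<in> N; q \<in> N\<rbrakk> \<Longrightarrow> coset p \<otimes>\<^bsub>L\<^esub> coset q = coset (p * q)"
  unfolding coset_def by (rule lpa_mult_cosets)

lemma zero_L: "\<zero>\<^bsub>L\<^esub> = coset 0"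
  by (simp add: leavitt_path_algebra_def FactRing_def coset_eq)

lemma bij_betw_embed: "bij_betw embed (carrier L) R"
proof -
  have eq: "coset p = coset q" if "p \<in> N" "q \<in> N" "\<kappa> p = \<kappa> q" for p q
  proof -
    have j: "p - q \<in> lpa_ideal G"
      using that \<kappa>_eq_iff by blast
    have "i + p \<in> coset q" if "i \<in> lpa_ideal G" for i
      unfolding coset_eq using lpa_ideal_closed(2)[OF that j] by (intro image_eqI[of _ _ "i + (p - q)"]) simp_all
    moreover have "i + q \<in> coset p" if "i \<in> lpa_ideal G" for i
      unfolding coset_eq using lpa_ideal_closed(2)[OF that lpa_ideal_closed(3)[OF j]]
      by (intro image_eqI[of _ _ "i + (q - p)"]) simp_all
    ultimately have "coset p \<subseteq> coset q" "coset q \<subseteq> coset p"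
      unfolding coset_eq[of p] coset_eq[of q] image_subset_iff by simp_all
    then show ?thesis
      by (rule subset_antisym)
  qed
  have "inj_on embed (coset ` N)"
  proof (rule inj_onI)
    fix x y assume "x \<in> coset ` N" "y \<in> coset ` N" "embed x = embed y"
    then show "x = y"
      by (elim imageE) (simp only: embed_coset, rule eq)
  qed
  then show ?thesis
    unfolding carrier_L bij_betw_def
    by (simp add: image_image embed_coset \<kappa>_image_N del: free_nonunital_algebra_simps(1))
qed

lemma embed_hom:
  assumes "x \<in> carrier L" "y \<in> carrier L"
  shows "embed (x \<oplus>\<^bsub>L\<^esub> y) = embed x + embed y" "embed (x \<otimes>\<^bsub>L\<^esub> y) = embed x * embed y"
    and "x \<oplus>\<^bsub>L\<^esub> y \<in> carrier L" "x \<otimes>\<^bsub>L\<^esub> y \<in> carrier L"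
proof -
  obtain p q where "p \<in> N" "q \<in> N" "x = coset p" "y = coset q"
    using assms unfolding carrier_L by blast
  then show "embed (x \<oplus>\<^bsub>L\<^esub> y) = embed x + embed y" "embed (x \<otimes>\<^bsub>L\<^esub> y) = embed x * embed y"
    "x \<oplus>\<^bsub>L\<^esub> y \<in> carrier L" "x \<otimes>\<^bsub>L\<^esub> y \<in> carrier L"
    unfolding carrier_L
    by (simp_all add: coset_add coset_mult embed_coset \<kappa>_add \<kappa>_mult N_closed(2,4) del: free_nonunital_algebra_simps(1))
qed

lemma embed_zero: "embed \<zero>\<^bsub>L\<^esub> = 0" "\<zero>\<^bsub>L\<^esub> \<in> carrier L"
  unfolding zero_L carrier_L by (auto simp: embed_coset \<kappa>_zero)

lemma embed_inj: "\<lbrakk>x \<in> carrier L; y \<in> carrier L; embed x = embed y\<rbrakk> \<Longrightarrow> x = y"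
  using bij_betw_embed by (auto simp: bij_betw_def inj_on_def)

lemma embed_R: "x \<in> carrier L \<Longrightarrow> embed x \<in> R"
  using bij_betw_embed by (auto simp: bij_betw_def)

lemma ex_embed: "r \<in> R \<Longrightarrow> \<exists>x\<in>carrier L. embed x = r"
  using bij_betw_embed by (force simp: bij_betw_def)

text \<open>The group laws are pulled back from \<open>R\<close> along the injective additive map
  \<open>embed\<close>.\<close>

lemma abelian_group_L: "abelian_group L"
proof (rule abelian_groupI)
  fix x y z assume *: "x \<in> carrier L" "y \<in> carrier L" "z \<in> carrier L"
  show "x \<oplus>\<^bsub>L\<^esub> y \<oplus>\<^bsub>L\<^esub> z = x \<oplus>\<^bsub>L\<^esub> (y \<oplus>\<^bsub>L\<^esub> z)"
    using * by (intro embed_inj) (simp_all add: embed_hom add.assoc)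
next
  fix x y assume *: "x \<in> carrier L" "y \<in> carrier L"
  show "x \<oplus>\<^bsub>L\<^esub> y = y \<oplus>\<^bsub>L\<^esub> x"
    using * by (intro embed_inj) (simp_all add: embed_hom add.commute)
next
  fix x assume x: "x \<in> carrier L"
  show "\<zero>\<^bsub>L\<^esub> \<oplus>\<^bsub>L\<^esub> x = x"
    using x by (intro embed_inj) (simp_all add: embed_hom embed_zero)
  obtain y where y: "y \<in> carrier L" "embed y = - embed x"
    using ex_embed R_uminus[OF embed_R[OF x]] by blast
  then have "y \<oplus>\<^bsub>L\<^esub> x = \<zero>\<^bsub>L\<^esub>"
    using x by (intro embed_inj) (simp_all add: embed_hom embed_zero)
  then show "\<exists>y\<in>carrier L. y \<oplus>\<^bsub>L\<^esub> x = \<zero>\<^bsub>L\<^esub>"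
    using y(1) by blast
qed (simp_all add: embed_hom embed_zero)

lemma embed_uminus:
  assumes "x \<in> carrier L"
  shows "embed (\<ominus>\<^bsub>L\<^esub> x) = - embed x"
proof -
  interpret abelian_group L
    by (rule abelian_group_L)
  have "embed (\<ominus>\<^bsub>L\<^esub> x) + embed x = 0"
    using assms embed_hom(1)[of "\<ominus>\<^bsub>L\<^esub> x" x] by (simp add: l_neg embed_zero)
  then show ?thesis
    by (simp add: eq_neg_iff_add_eq_0)
qed

lemma left_ideal_iff_lideal:
  assumes "J \<subseteq> carrier L"
  shows "left_ideal J L \<longleftrightarrow> lideal (embed ` J)"
proof
  interpret abelian_group L
    by (rule abelian_group_L)
  assume J: "left_ideal J L"
  then interpret J: additive_subgroup J L
    by (simp add: left_ideal_def)
  show "lideal (embed ` J)"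
    unfolding lideal_def
  proof (intro conjI ballI)
    show "embed ` J \<subseteq> R"
      by (intro image_subsetI embed_R subsetD[OF assms])
    show "0 \<in> embed ` J"
      using imageI[OF additive_subgroup.zero_closed[OF J.additive_subgroup_axioms], of embed]
      by (simp only: embed_zero(1))
  next
    fix a b assume "a \<in> embed ` J" "b \<in> embed ` J"
    then obtain x y where xy: "x \<in> J" "y \<in> J" "a = embed x" "b = embed y"
      by (elim imageE)
    have "x \<oplus>\<^bsub>L\<^esub> y \<in> J"
      using additive_subgroup.a_closed[OF J.additive_subgroup_axioms xy(1,2)] .
    moreover have "a + b = embed (x \<oplus>\<^bsub>L\<^esub> y)"
      by (simp only: xy(3,4) embed_hom(1) subsetD[OF assms xy(1)] subsetD[OF assms xy(2)])
    ultimately show "a + b \<in> embed ` J"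
      by (simp only: imageI)
  next
    fix a assume "a \<in> embed ` J"
    then obtain x where x: "x \<in> J" "a = embed x"
      by (elim imageE)
    have "\<ominus>\<^bsub>L\<^esub> x \<in> J"
      by (rule J.a_inv_closed[OF x(1)])
    moreover have "- a = embed (\<ominus>\<^bsub>L\<^esub> x)"
      by (simp only: x(2) embed_uminus subsetD[OF assms x(1)])
    ultimately show "- a \<in> embed ` J"
      by (simp only: imageI)
  next
    fix r a assume "r \<in> R" "a \<in> embed ` J"
    from ex_embed[OF this(1)] obtain s where s: "s \<in> carrier L" "embed s = r"
      by (elim bexE)
    obtain x where x: "x \<in> J" "a = embed x"
      using \<open>a \<in> embed ` J\<close> by (elim imageE)
    have "s \<otimes>\<^bsub>L\<^esub> x \<in> J"
      using J s(1) x(1) by (simp add: left_ideal_def)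
    moreover have "r * a = embed (s \<otimes>\<^bsub>L\<^esub> x)"
      by (simp only: s(2)[symmetric] x(2) embed_hom(2) s(1) subsetD[OF assms x(1)])
    ultimately show "r * a \<in> embed ` J"
      by (simp only: imageI)
  qed
next
  interpret abelian_group L
    by (rule abelian_group_L)
  assume "lideal (embed ` J)"
  note M = lidealD[OF this]
  have mem: "x \<in> J" if "x \<in> carrier L" "embed x \<in> embed ` J" for x
    using that assms embed_inj by blast
  have "subgroup J (add_monoid L)"
  proof
    show "J \<subseteq> carrier (add_monoid L)"
      using assms by simp
    show "\<one>\<^bsub>add_monoid L\<^esub> \<in> J"
      using mem[of "\<zero>\<^bsub>L\<^esub>"] M(2) by (simp add: embed_zero)
    show "x \<otimes>\<^bsub>add_monoid L\<^esub> y \<in> J" if "x \<in> J" "y \<in> J" for x y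
    proof -
      have "x \<in> carrier L" "y \<in> carrier L"
        using that assms by auto
      then show ?thesis
        using mem[of "x \<oplus>\<^bsub>L\<^esub> y"] M(3)[of "embed x" "embed y"] that by (simp add: embed_hom)
    qed
    show "inv\<^bsub>add_monoid L\<^esub> x \<in> J" if "x \<in> J" for x
    proof -
      have "x \<in> carrier L"
        using that assms by auto
      then have "\<ominus>\<^bsub>L\<^esub> x \<in> J"
        using mem[of "\<ominus>\<^bsub>L\<^esub> x"] M(4)[of "embed x"] that by (simp add: embed_uminus)
      then show ?thesis
        by (simp add: a_inv_def)
    qed
  qed
  moreover have "s \<otimes>\<^bsub>L\<^esub> x \<in> J" if "s \<in> carrier L" "x \<in> J" for s x
  proof -
    have "x \<in> carrier L"
      using that assms by auto
    then show ?thesis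
      using mem[of "s \<otimes>\<^bsub>L\<^esub> x"] M(5)[OF embed_R[OF that(1)], of "embed x"] that by (simp add: embed_hom)
  qed
  ultimately show "left_ideal J L"
    by (simp add: left_ideal_def additive_subgroup_def)
qed

lemma min_lideal_embed:
  assumes "minimal_left_ideal I L"
  shows "I \<subseteq> carrier L" "min_lideal (embed ` I)"
proof -
  have I: "left_ideal I L" "I \<noteq> {\<zero>\<^bsub>L\<^esub>}"
    "\<And>J. \<lbrakk>left_ideal J L; J \<subseteq> I\<rbrakk> \<Longrightarrow> J = {\<zero>\<^bsub>L\<^esub>} \<or> J = I"
    using assms unfolding minimal_left_ideal_def by blast+
  show sub: "I \<subseteq> carrier L"
    using I(1) additive_subgroup.a_subset by (auto simp: left_ideal_def)
  show "min_lideal (embed ` I)"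
    unfolding min_lideal_def
  proof (intro conjI allI impI)
    show M: "lideal (embed ` I)"
      using I(1) sub left_ideal_iff_lideal by blast
    show "embed ` I \<noteq> {0}"
    proof
      assume *: "embed ` I = {0}"
      then have "x = \<zero>\<^bsub>L\<^esub>" if "x \<in> I" for x
        using that sub embed_zero by (intro embed_inj) auto
      then show False
        using I(2) * by blast
    qed
    fix M' assume M': "lideal M' \<and> M' \<subseteq> embed ` I"
    define J where "J = {x \<in> I. embed x \<in> M'}"
    have J: "embed ` J = M'" "J \<subseteq> I"
      using M' by (auto simp: J_def)
    then have "left_ideal J L"
      using M' sub left_ideal_iff_lideal[of J] by auto
    then have "J = {\<zero>\<^bsub>L\<^esub>} \<or> J = I"
      using I(3) J(2) by blast
    then show "M' = {0} \<or> M' = embed ` I"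
      using J(1) embed_zero(1) by auto
  qed
qed

lemma embed_PIdl_vertex:
  assumes "v \<in> verts G"
  shows "embed ` (PIdl\<^bsub>L\<^esub> (lpa_vertex G v)) = (\<lambda>a. a * V v) ` R"
    and "PIdl\<^bsub>L\<^esub> (lpa_vertex G v) \<subseteq> carrier L"
proof -
  have "generator (Vertex v) \<in> N"
    using assms by (intro N_closed(6)) (simp add: lpa_gens_def)
  then have v: "lpa_vertex G v \<in> carrier L" "embed (lpa_vertex G v) = V v"
    unfolding carrier_L using embed_coset[of "generator (Vertex v)"]
    by (auto simp: lpa_vertex_def coset_def simp del: free_nonunital_algebra_simps(1))
  \<comment> \<open>By its definition \<open>PIdl\<close> consists of the left multiples of the
    vertex, so it is the left module L v without any appeal to commutativity.\<close>
  have PIdl: "PIdl\<^bsub>L\<^esub> (lpa_vertex G v) = (\<lambda>x. x \<otimes>\<^bsub>L\<^esub> lpa_vertex G v) ` carrier L"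
    by (auto simp: cgenideal_def)
  show "PIdl\<^bsub>L\<^esub> (lpa_vertex G v) \<subseteq> carrier L"
    unfolding PIdl using v(1) embed_hom(4) by blast
  have "embed ` (PIdl\<^bsub>L\<^esub> (lpa_vertex G v)) = (\<lambda>x. embed x * V v) ` carrier L"
    unfolding PIdl image_image using v by (intro image_cong) (simp_all add: embed_hom)
  also have "\<dots> = (\<lambda>a. a * V v) ` (embed ` carrier L)"
    by (simp add: image_image)
  also have "embed ` carrier L = R"
    using bij_betw_embed by (simp add: bij_betw_def)
  finally show "embed ` (PIdl\<^bsub>L\<^esub> (lpa_vertex G v)) = (\<lambda>a. a * V v) ` R" .
qed

lemma minimal_left_ideal_isomorphic:
  assumes "minimal_left_ideal I L"
  shows "\<exists>v \<in> verts G. line_point G v \<and> left_module_isomorphic L I (PIdl\<^bsub>L\<^esub> (lpa_vertex G v))"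
proof -
  note sub = min_lideal_embed(1)[OF assms]
  note M = lidealD[OF min_lideal_lideal[OF min_lideal_embed(2)[OF assms]]]
  obtain v n where v: "line_point G v" and n: "n \<in> R" "\<forall>a\<in>embed ` I. a * n = 0 \<longrightarrow> a = 0"
    and eq: "(\<lambda>a. a * n) ` embed ` I = (\<lambda>a. a * V v) ` R"
    using min_lideal_line_point_principal[OF min_lideal_embed(2)[OF assms]]
    unfolding line_point_principal_def by (elim exE conjE) (rule that; assumption)
  have vG: "v \<in> verts G"
    using v by (simp add: line_point_def)
  \<comment> \<open>Right multiplication by \<open>n\<close>, carried back along
    \<open>embed\<close>; associativity makes it left linear.\<close>
  define h where "h x = inv_into (carrier L) embed (embed x * n)" for x
  have h: "h x \<in> carrier L" "embed (h x) = embed x * n" if "x \<in> carrier L" for x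
  proof -
    have "embed x * n \<in> embed ` carrier L"
      using R_mult[OF embed_R[OF that] n(1)] bij_betw_embed by (simp add: bij_betw_def)
    then show "h x \<in> carrier L" "embed (h x) = embed x * n"
      unfolding h_def by (rule inv_into_into, rule f_inv_into_f)
  qed
  have "inj_on h I"
  proof (rule inj_onI)
    fix x y assume xy: "x \<in> I" "y \<in> I" "h x = h y"
    then have "embed x * n = embed y * n"
      using h(2)[OF subsetD[OF sub xy(1)]] h(2)[OF subsetD[OF sub xy(2)]] by simp
    then have "(embed x + - embed y) * n = 0"
      by (simp add: left_diff_distrib)
    moreover have "embed x + - embed y \<in> embed ` I"
      using M(3)[OF imageI[OF xy(1)] M(4)[OF imageI[OF xy(2)]]] .
    ultimately have "embed x + - embed y = 0"
      using n(2) by (simp only: Ball_def)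
    then have "embed x = embed y"
      by simp
    then show "x = y"
      using subsetD[OF sub xy(1)] subsetD[OF sub xy(2)] by (rule embed_inj[rotated 2])
  qed
  moreover have "h ` I = PIdl\<^bsub>L\<^esub> (lpa_vertex G v)"
  proof -
    have "embed ` (h ` I) = (\<lambda>x. embed x * n) ` I"
      unfolding image_image using h(2) sub by (intro image_cong) auto
    then have "embed ` (h ` I) = embed ` (PIdl\<^bsub>L\<^esub> (lpa_vertex G v))"
      using eq embed_PIdl_vertex(1)[OF vG] by (simp add: image_image)
    moreover have "inj_on embed (carrier L)"
      using bij_betw_embed by (simp add: bij_betw_def)
    moreover have "h ` I \<subseteq> carrier L"
      using h(1) sub by blast
    ultimately show ?thesis
      using embed_PIdl_vertex(2)[OF vG] by (simp add: inj_on_image_eq_iff)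
  qed
  moreover have "h (x \<oplus>\<^bsub>L\<^esub> y) = h x \<oplus>\<^bsub>L\<^esub> h y" if "x \<in> I" "y \<in> I" for x y
  proof -
    have "x \<in> carrier L" "y \<in> carrier L"
      using that sub by auto
    then show ?thesis
      by (intro embed_inj) (simp_all add: h embed_hom distrib_right)
  qed
  moreover have "h (a \<otimes>\<^bsub>L\<^esub> x) = a \<otimes>\<^bsub>L\<^esub> h x" if "a \<in> carrier L" "x \<in> I" for a x
  proof -
    have "x \<in> carrier L"
      using that sub by auto
    then show ?thesis
      using that(1) by (intro embed_inj) (simp_all add: h embed_hom mult.assoc)
  qed
  ultimately have "left_module_isomorphic L I (PIdl\<^bsub>L\<^esub> (lpa_vertex G v))"
    unfolding left_module_isomorphic_def bij_betw_def by (intro exI[of _ h]) simp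
  then show ?thesis
    using v vG by blast
qed

end

theorem proposition3p13:
  fixes E :: "('v, 'e) pre_digraph"
    and I :: "('v, 'e, 'k::field) lpa set"
  assumes "wf_digraph E"
    and "minimal_left_ideal I (leavitt_path_algebra E)"
  shows "\<exists>v \<in> verts E. line_point E v \<and>
    left_module_isomorphic (leavitt_path_algebra E) I
      (PIdl\<^bsub>leavitt_path_algebra E\<^esub> (lpa_vertex E v))"
proof -
  interpret wf_digraph E
    by (rule assms(1))
  obtain \<kappa> :: "('v, 'e, 'k) free_lpa \<Rightarrow> (('v, 'e) lpa_gen list, 'k) lin_end" where
    "\<And>p q. \<kappa> (p + q) = \<kappa> p + \<kappa> q" "\<And>p q. \<kappa> (p * q) = \<kappa> p * \<kappa> q"
    "\<And>k p. \<kappa> (scalar k * p) = scale_end k (\<kappa> p)" "\<And>p. \<kappa> p = 0 \<longleftrightarrow> p \<in> full_ideal"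
    by (rule ex_lpa_embedding) (assumption | rule that)+
  then interpret lpa_embedding E \<kappa>
    by unfold_locales
  show ?thesis
    using assms(2) by (rule minimal_left_ideal_isomorphic)
qed

end
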